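(* Fix a (set-valued) compatible, irreducible Pisot random substitution $\vartheta$ on $\mathcal A=\{1,\dots,d\}$. For each non-degenerate choice of probabilities $\mathbf P$ let $\overline\mu(\vartheta,\mathbf P)=(\overline\mu_a(\vartheta,\mathbf P))_{a\in\mathcal A}$ be the vector of Rauzy measures of $\vartheta_{\mathbf P}=(\vartheta,\mathbf P)$. Then, for every $a\in\mathcal A$, the probability measure $R_a^{-1}\overline\mu_a(\vartheta,\mathbf P)$ depends continuously on the probability parameters in $\mathbf P$ with respect to the Monge–Kantorovich metric. The same holds with respect to the topology of weak convergence.
   Context: Let $\mathcal A^+$ be the set of non-empty finite words over $\mathcal A$, $|u|$ the length of $u$, $|u|_i$ the number of occurrences of $i$ in $u$, $\psi(u)=(|u|_1,\dots,|u|_d)^T$, and $u_{[1,m]}=u_1\cdots u_m$ (empty if $m=0$). A random substitution $\vartheta_{\mathbf P}=(\vartheta,\mathbf P)$ is a map $\vartheta$ assigning to each letter $i$ a non-empty finite set $\vartheta(i)\subset\mathcal A^+$ together with a non-degenerate choice of probabilities $\mathbf P=(p_i)_{i\in\mathcal A}$, $p_i\colon\vartheta(i)\to(0,1]$, $\sum_{v\in\vartheta(i)}p_i(v)=1$ (the set of all $\mathbf P$ carries its natural Euclidean topology). For a word $u=u_1\cdots u_n$, $\vartheta_{\mathbf P}(u)$ is the random word obtained by independently replacing each letter $u_k$ by $v\in\vartheta(u_k)$ with probability $p_{u_k}(v)$ and concatenating in order; $(\vartheta_{\mathbf P}^n(u))_{n\ge0}$ is the Markov chain on $\mathcal A^+$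 started at $u$ with these transition probabilities, and $\mathbb E$ is the corresponding expectation. It is compatible if $\psi(u)=\psi(v)$ for all $a\in\mathcal A$, $u,v\in\vartheta(a)$; then all realisations of $\vartheta_{\mathbf P}^n(v)$ have a common length $|\vartheta^n(v)|$, and the substitution matrix is $M_{i,j}=|v|_i$ for any $v\in\vartheta(j)$. It is primitive if $M$ is primitive with Perron–Frobenius eigenvalue $\lambda>1$. A compatible primitive random substitution is irreducible Pisot if $\lambda$ is a Pisot number and the characteristic polynomial of $M$ is irreducible over $\mathbb Z$. These properties and $M$ do not depend on $\mathbf P$. $\mathbf L,\mathbf R=(R_1,\dots,R_d)^T$ are left and right Perron–Frobenius eigenvectors of $M$ with $\|\mathbf R\|_1=1=\mathbf L^T\mathbf R$; $\mathbb H\subset\mathbb R^d$ is the hyperplane orthogonal to $\mathbf L$ (with a metric induced by a norm); $\pi$ is the linear projection along $\mathbf R$ onto $\mathbb H$. For a finite word $w$ and $a\in\mathcal A$, $\mu_a(w)=\sum_{0\le m\le|w|-1,\ w_{m+1}=a}\delta_{\pi(\psi(w_{[1,m]}))}$. The Rauzy measure $\overline\mu_a=\overline\mu_a(\vartheta,\mathbf P)$ is the weak limit $\overline\mu_a=\lim_{n\to\infty}|\vartheta^n(v)|^{-1}\,\mathbb E[\mu_a(\vartheta_{\mathbf P}^n(v))]$, which exists and is the same for every $v\in\mathcal A^+$; it is compactly supported with total mass $R_a$. The Monge–Kantorovich metric between probability measures $\mu,\nu$ on a metric space $X$ is $d_{\mathrm{MK}}(\mu,\nu)=\sup_g|\int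 g\,d\mu-\int g\,d\nu|$, the supremum being over all $g\colon X\to\mathbb R$ with Lipschitz constant at most $1$. *)

theory Defs
  imports "HOL-Probability.Probability" "HOL-Computational_Algebra.Computational_Algebra"
begin

section \<open>Random substitutions\<close>

text \<open>
  The alphabet is a finite type \<open>'a\<close>, so \<open>d = CARD('a)\<close>. A word is a list.
\<close>

definition set_substitution :: "('a \<Rightarrow> 'a list set) \<Rightarrow> bool" where
  "set_substitution \<theta> \<longleftrightarrow> (\<forall>i. finite (\<theta> i) \<and> \<theta> i \<noteq> {} \<and> [] \<notin> \<theta> i)"

text \<open>
  The value \<open>P i v\<close> is \<open>p\<^sub>i(v)\<close>, extended by \<open>0\<close> to words outside \<open>\<theta> i\<close>. As \<open>'a\<close> and all
  \<open>\<theta> i\<close> are finite, only finitely many coordinates vary on this set, and the topology it inherits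
  from the product topology of \<open>'a \<Rightarrow> 'a list \<Rightarrow> real\<close> is the Euclidean one.
\<close>

definition prob_choices :: "('a \<Rightarrow> 'a list set) \<Rightarrow> ('a \<Rightarrow> 'a list \<Rightarrow> real) set" where
  "prob_choices \<theta> =
    {P. \<forall>i. (\<forall>v\<in>\<theta> i. P i v \<in> {0<..1}) \<and> (\<forall>v. v \<notin> \<theta> i \<longrightarrow> P i v = 0) \<and> (\<Sum>v\<in>\<theta> i. P i v) = 1}"

primrec random_image :: "('a \<Rightarrow> 'a list \<Rightarrow> real) \<Rightarrow> 'a list \<Rightarrow> 'a list pmf" where
  "random_image P [] = return_pmf []"
| "random_image P (i # u) =
     bind_pmf (embed_pmf (P i)) (\<lambda>v. map_pmf (\<lambda>w. v @ w) (random_image P u))"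

text \<open>The law at time \<open>n\<close> of the Markov chain started at \<open>u\<close>.\<close>

primrec random_iterate :: "('a \<Rightarrow> 'a list \<Rightarrow> real) \<Rightarrow> nat \<Rightarrow> 'a list \<Rightarrow> 'a list pmf" where
  "random_iterate P 0 u = return_pmf u"
| "random_iterate P (Suc n) u = bind_pmf (random_iterate P n u) (random_image P)"

text \<open>Meaningful for compatible substitutions, where all realisations have the same length.\<close>

definition iterate_length :: "('a \<Rightarrow> 'a list \<Rightarrow> real) \<Rightarrow> nat \<Rightarrow> 'a list \<Rightarrow> nat" where
  "iterate_length P n u = (THE l. \<forall>w\<in>set_pmf (random_iterate P n u). length w = l)"

definition abelianisation :: "'a::finite list \<Rightarrow> real ^ 'a" where
  "abelianisation u = (\<chi> i. real (count_list u i))"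

definition compatible :: "('a::finite \<Rightarrow> 'a list set) \<Rightarrow> bool" where
  "compatible \<theta> \<longleftrightarrow> (\<forall>i. \<forall>u\<in>\<theta> i. \<forall>v\<in>\<theta> i. abelianisation u = abelianisation v)"

text \<open>For compatible \<open>\<theta>\<close> the chosen realisation is irrelevant.\<close>

definition subst_matrix :: "('a::finite \<Rightarrow> 'a list set) \<Rightarrow> int ^ 'a ^ 'a" where
  "subst_matrix \<theta> = (\<chi> i j. int (count_list (SOME v. v \<in> \<theta> j) i))"


section \<open>Perron--Frobenius data and the Pisot property\<close>

definition primitive_matrix :: "int ^ 'n ^ 'n \<Rightarrow> bool" where
  "primitive_matrix M \<longleftrightarrow>
    (\<forall>i j. 0 \<le> M $ i $ j) \<and> (\<exists>k>0. \<forall>i j. 0 < (((**) M ^^ k) (mat 1)) $ i $ j)"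

definition is_eigenvalue :: "'b::field ^ 'n ^ 'n \<Rightarrow> 'b \<Rightarrow> bool" where
  "is_eigenvalue A z \<longleftrightarrow> (\<exists>x. x \<noteq> 0 \<and> A *v x = z *s x)"

definition pf_eigenvalue :: "int ^ 'n ^ 'n \<Rightarrow> real \<Rightarrow> bool" where
  "pf_eigenvalue M l \<longleftrightarrow>
    is_eigenvalue (map_matrix of_int M) l \<and>
    (\<forall>z::complex. is_eigenvalue (map_matrix of_int M) z \<longrightarrow> z \<noteq> of_real l \<longrightarrow> cmod z < l)"

definition right_pf_eigenvector :: "int ^ 'n ^ 'n \<Rightarrow> real ^ 'n \<Rightarrow> bool" where
  "right_pf_eigenvector M x \<longleftrightarrow>
    (\<forall>i. 0 < x $ i) \<and> (\<exists>l. pf_eigenvalue M l \<and> map_matrix of_int M *v x = l *s x)"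

definition left_pf_eigenvector :: "int ^ 'n ^ 'n \<Rightarrow> real ^ 'n \<Rightarrow> bool" where
  "left_pf_eigenvector M x \<longleftrightarrow>
    (\<forall>i. 0 < x $ i) \<and> (\<exists>l. pf_eigenvalue M l \<and> x v* map_matrix of_int M = l *s x)"

definition charpoly :: "int ^ 'n ^ 'n \<Rightarrow> int poly" where
  "charpoly M = det (\<chi> i j. (if i = j then [:0, 1:] else 0) - [:M $ i $ j:])"

text \<open>
  The polynomial \<open>p\<close> below is the minimal polynomial of the algebraic integer \<open>x\<close>, so its complex
  roots are the Galois conjugates of \<open>x\<close>.
\<close>

definition pisot_number :: "real \<Rightarrow> bool" where
  "pisot_number x \<longleftrightarrow> 1 < x \<and>
    (\<exists>p::int poly. lead_coeff p = 1 \<and> irreducible p \<and> poly (map_poly of_int p) x = 0 \<and>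
      (\<forall>z::complex. poly (map_poly of_int p) z = 0 \<longrightarrow> z \<noteq> of_real x \<longrightarrow> cmod z < 1))"

definition primitive_subst :: "('a::finite \<Rightarrow> 'a list set) \<Rightarrow> bool" where
  "primitive_subst \<theta> \<longleftrightarrow>
    primitive_matrix (subst_matrix \<theta>) \<and> (\<exists>l>1. pf_eigenvalue (subst_matrix \<theta>) l)"

definition irreducible_pisot :: "('a::finite \<Rightarrow> 'a list set) \<Rightarrow> bool" where
  "irreducible_pisot \<theta> \<longleftrightarrow> compatible \<theta> \<and> primitive_subst \<theta> \<and>
    (\<exists>l. pf_eigenvalue (subst_matrix \<theta>) l \<and> pisot_number l) \<and>
    irreducible (charpoly (subst_matrix \<theta>))"


section \<open>Convergence of measures\<close>

text \<open>Measures on a subset \<open>X\<close> are measures with space \<open>X\<close> and the Borel sets of \<open>X\<close>.\<close>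

definition weakly_tendsto ::
    "('b \<Rightarrow> 'x::topological_space measure) \<Rightarrow> 'x measure \<Rightarrow> 'b filter \<Rightarrow> bool" where
  "weakly_tendsto \<mu> \<nu> F \<longleftrightarrow>
    (\<forall>g :: 'x \<Rightarrow> real. continuous_on (space \<nu>) g \<longrightarrow> bounded (g ` space \<nu>) \<longrightarrow>
      ((\<lambda>t. \<integral>x. g x \<partial>\<mu> t) \<longlongrightarrow> (\<integral>x. g x \<partial>\<nu>)) F)"

text \<open>
  The second argument of the Monge--Kantorovich distance determines the underlying space, with
  metric \<open>\<delta>\<close>. Values are in \<open>ennreal\<close> so that the supremum is meaningful in all cases.
\<close>

definition mk_dist :: "('x \<Rightarrow> 'x \<Rightarrow> real) \<Rightarrow> 'x measure \<Rightarrow> 'x measure \<Rightarrow> ennreal" where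
  "mk_dist \<delta> \<mu> \<nu> =
    (SUP g \<in> {g :: 'x \<Rightarrow> real. \<forall>x\<in>space \<nu>. \<forall>y\<in>space \<nu>. \<bar>g x - g y\<bar> \<le> \<delta> x y}.
      ennreal \<bar>(\<integral>x. g x \<partial>\<mu>) - (\<integral>x. g x \<partial>\<nu>)\<bar>)"

definition norm_on :: "'v::real_vector set \<Rightarrow> ('v \<Rightarrow> real) \<Rightarrow> bool" where
  "norm_on S \<eta> \<longleftrightarrow>
    (\<forall>x\<in>S. 0 \<le> \<eta> x \<and> (\<eta> x = 0 \<longleftrightarrow> x = 0)) \<and>
    (\<forall>c. \<forall>x\<in>S. \<eta> (c *\<^sub>R x) = \<bar>c\<bar> * \<eta> x) \<and>
    (\<forall>x\<in>S. \<forall>y\<in>S. \<eta> (x + y) \<le> \<eta> x + \<eta> y)"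


section \<open>Rauzy measures\<close>

definition orth_hyperplane :: "real ^ 'n \<Rightarrow> (real ^ 'n) set" where
  "orth_hyperplane L = {x. L \<bullet> x = 0}"

text \<open>
  For \<open>L \<bullet> R = 1\<close>, this is the linear map with kernel spanned by \<open>R\<close> that is the identity on
  \<open>orth_hyperplane L\<close>.
\<close>

definition proj_along :: "real ^ 'n \<Rightarrow> real ^ 'n \<Rightarrow> real ^ 'n \<Rightarrow> real ^ 'n" where
  "proj_along L R x = x - (L \<bullet> x) *\<^sub>R R"

abbreviation hyperplane_borel :: "real ^ 'n \<Rightarrow> (real ^ 'n) measure" where
  "hyperplane_borel L \<equiv> restrict_space borel (orth_hyperplane L)"

text \<open>
  The sum of Dirac measures over the positions of \<open>a\<close> in \<open>w\<close>, written as the image of counting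
  measure on these positions. Positions are counted from \<open>0\<close>, so \<open>w ! m\<close> is \<open>w\<^sub>m\<^sub>+\<^sub>1\<close>.
\<close>

definition word_measure ::
    "real ^ 'a \<Rightarrow> real ^ 'a \<Rightarrow> 'a \<Rightarrow> 'a::finite list \<Rightarrow> (real ^ 'a) measure" where
  "word_measure L R a w =
    distr (count_space {m. m < length w \<and> w ! m = a}) (hyperplane_borel L)
      (\<lambda>m. proj_along L R (abelianisation (take m w)))"

definition expected_word_measure ::
    "real ^ 'a \<Rightarrow> real ^ 'a \<Rightarrow> 'a \<Rightarrow> 'a::finite list pmf \<Rightarrow> (real ^ 'a) measure" where
  "expected_word_measure L R a p =
    measure_of (orth_hyperplane L) (sets (hyperplane_borel L))
      (\<lambda>B. \<integral>\<^sup>+ w. emeasure (word_measure L R a w) B \<partial>measure_pmf p)"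

definition rauzy_measure ::
    "real ^ 'a \<Rightarrow> real ^ 'a \<Rightarrow> ('a \<Rightarrow> 'a list \<Rightarrow> real) \<Rightarrow> 'a::finite \<Rightarrow> (real ^ 'a) measure" where
  "rauzy_measure L R P a =
    (THE \<mu>. finite_measure \<mu> \<and> sets \<mu> = sets (hyperplane_borel L) \<and>
      (\<forall>v. v \<noteq> [] \<longrightarrow>
        weakly_tendsto
          (\<lambda>n. scale_measure (ennreal (1 / real (iterate_length P n v)))
                 (expected_word_measure L R a (random_iterate P n v)))
          \<mu> sequentially))"

definition normalised_rauzy_measure ::
    "real ^ 'a \<Rightarrow> real ^ 'a \<Rightarrow> ('a \<Rightarrow> 'a list \<Rightarrow> real) \<Rightarrow> 'a::finite \<Rightarrow> (real ^ 'a) measure" where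
  "normalised_rauzy_measure L R P a =
    scale_measure (ennreal (1 / R $ a)) (rauzy_measure L R P a)"

end

theory Submission
  imports Defs
begin

text \<open>
  Write \<open>A\<close> for the substitution matrix, \<open>\<lambda>\<close> for its Perron--Frobenius eigenvalue, \<open>H\<close> for the
  hyperplane orthogonal to \<open>L\<close> and \<open>\<pi>\<close> for the projection onto it. The eigenvalues of \<open>A\<close> on \<open>H\<close> are
  roots of the irreducible characteristic polynomial other than \<open>\<lambda>\<close>, hence conjugates of a Pisot
  number, and so \<open>A\<close> contracts \<open>H\<close> by a factor \<open>\<rho> < 1\<close> in a suitable norm.

  Test functions are taken in families \<open>G\<close>, one function on \<open>H\<close> for each letter, and the measures of
  a word \<open>w\<close> are tested through the sum of \<open>G\<close> over the positions of \<open>w\<close> (\<open>path_sum\<close>). By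
  compatibility the path of a random image of \<open>w\<close> follows \<open>A\<close> applied to the path of \<open>w\<close>, so the mean
  path sum of the image is the path sum over \<open>w\<close> itself of a new family \<open>T\<^sub>P G\<close> (\<open>transfer\<close>), and the
  expectation at time \<open>n\<close> is a path sum of \<open>T\<^sub>P\<^sup>n G\<close> over the initial word
  (\<open>expectation_random_iterate\<close>). Everything is thereby a question about the powers of the positive
  operators \<open>T\<^sub>P\<close>.

  A Markov chain supplies the limit. Reading the hierarchy of the substitution upwards from a letter
  \<open>a\<close>, one chooses at random which position of which image of which letter the current letter
  occupies; the position inside the infinite hierarchy is the convergent series of \<open>A\<^sup>k\<close> applied to the
  prefix at level \<open>k\<close> (\<open>address\<close>). Its self-similarity says that
  \<open>J\<^sub>P(G) = \<Sum>\<^sub>a R\<^sub>a E[G\<^sub>a(address)]\<close> satisfies \<open>J\<^sub>P(T\<^sub>P G) = \<lambda> J\<^sub>P(G)\<close> (\<open>mean_transfer\<close>). On the other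
  hand \<open>T\<^sub>P\<^sup>n G\<close> is nearly constant on bounded sets relative to its size \<open>\<lambda>\<^sup>n\<close>, because it evaluates \<open>G\<close>
  at points whose differences have been contracted by \<open>A\<^sup>n\<close>. Both facts together give
  \<open>\<lambda>\<^sup>-\<^sup>n T\<^sub>P\<^sup>n G \<rightarrow> J\<^sub>P(G) L\<close> (\<open>transfer_pow_tendsto\<close>), so the Rauzy measure of \<open>a\<close> exists and is \<open>R\<^sub>a\<close>
  times the law of the address of \<open>a\<close> (\<open>rauzy_measure_eq\<close>).

  For continuity in the Monge--Kantorovich metric, let \<open>G\<close> be a family whose members \<open>G\<^sub>a\<close> have
  Lipschitz constants \<open>k L\<^sub>a\<close>. Then \<open>\<lambda>\<^sup>-\<^sup>1 T\<^sub>P G\<close> is such a family with \<open>\<rho> k\<close> in place of \<open>k\<close>, and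
  \<open>\<lambda>\<^sup>-\<^sup>1(T\<^sub>P G - T\<^sub>Q G)\<close> is bounded, where the addresses lie, by a multiple of \<open>k\<close> times the distance of
  \<open>P\<close> and \<open>Q\<close>. Iterating
  \<open>J\<^sub>P(G) - J\<^sub>Q(G) = \<lambda>\<^sup>-\<^sup>1 (J\<^sub>P(T\<^sub>P G) - J\<^sub>Q(T\<^sub>Q G))\<close> shows that the measures even depend Lipschitz
  continuously on \<open>P\<close> (\<open>mean_lipschitz\<close>). For weak continuity, \<open>J\<^sub>P(G)\<close> is approximated uniformly in
  \<open>P\<close> by \<open>\<lambda>\<^sup>-\<^sup>n \<Sum>\<^sub>b R\<^sub>b (T\<^sub>P\<^sup>n G)\<^sub>b(0)\<close>, which is a polynomial in the probabilities (\<open>mean_tendsto\<close>).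
\<close>

no_notation fps_nth (infixl "$" 75)

section \<open>Integer polynomials and eigenvalues\<close>

abbreviation int_poly_eval :: "int poly \<Rightarrow> 'b::comm_ring_1 \<Rightarrow> 'b" where
  "int_poly_eval p x \<equiv> poly (map_poly of_int p) x"

lemma int_poly_eval_pCons: "int_poly_eval (pCons c p) x = of_int c + x * int_poly_eval p x"
  by (simp add: map_poly_pCons)

lemma int_poly_eval_add: "int_poly_eval (p + q) x = int_poly_eval p x + int_poly_eval q x"
proof (induction p arbitrary: q)
  case (pCons c p)
  then show ?case by (cases q) (simp add: int_poly_eval_pCons algebra_simps)
qed simp

lemma int_poly_eval_smult: "int_poly_eval (smult c p) x = of_int c * int_poly_eval p x"
  by (induction p) (simp_all add: int_poly_eval_pCons algebra_simps)

lemma int_poly_eval_mult: "int_poly_eval (p * q) x = int_poly_eval p x * int_poly_eval q x"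
  by (induction p)
    (simp_all add: int_poly_eval_add int_poly_eval_smult int_poly_eval_pCons algebra_simps)

lemma int_poly_eval_sum: "int_poly_eval (sum f S) x = (\<Sum>s\<in>S. int_poly_eval (f s) x)"
  by (induction S rule: infinite_finite_induct) (simp_all add: int_poly_eval_add)

lemma int_poly_eval_prod: "int_poly_eval (prod f S) x = (\<Prod>s\<in>S. int_poly_eval (f s) x)"
  by (induction S rule: infinite_finite_induct)
    (simp_all add: int_poly_eval_mult int_poly_eval_pCons one_pCons)

lemma int_poly_eval_of_int: "int_poly_eval (of_int k) x = of_int k"
  by (simp add: of_int_poly int_poly_eval_pCons)

lemma int_poly_eval_of_real:
  "int_poly_eval p (of_real x :: complex) = of_real (int_poly_eval p x)"
  by (induction p) (simp_all add: int_poly_eval_pCons)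

text \<open>
  Let \<open>m\<close> be a nonzero integer polynomial of least degree vanishing at \<open>x\<close>. Pseudo-division shows that
  every integer polynomial vanishing at \<open>x\<close> becomes a multiple of \<open>m\<close> after multiplication by a nonzero
  integer. Since \<open>c\<close> is a prime element, comparing these multiples for \<open>c\<close> and \<open>p\<close> forces \<open>c\<close> to divide
  \<open>p\<close>.
\<close>

lemma irreducible_int_poly_dvd_of_common_root:
  fixes c p :: "int poly" and x :: "'b::field_char_0"
  assumes c: "irreducible c" and p: "irreducible p"
    and cx: "int_poly_eval c x = 0" and px: "int_poly_eval p x = 0"
  shows "c dvd p"
proof -
  have not_const: "degree f \<noteq> 0" if "f \<noteq> 0" "int_poly_eval f x = 0" for f :: "int poly"
  proof
    assume "degree f = 0"
    then obtain k where "f = [:k:]" by (rule degree_eq_zeroE)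
    with that show False by (simp add: int_poly_eval_pCons)
  qed
  let ?V = "\<lambda>f::int poly. f \<noteq> 0 \<and> int_poly_eval f x = 0"
  have cV: "?V c" and pV: "?V p" using assms by auto
  obtain m where m: "?V m" and min: "\<And>f. ?V f \<Longrightarrow> degree m \<le> degree f"
    using cV ex_has_least_nat[of ?V c degree] by blast
  have multiple: "\<exists>a q. a \<noteq> 0 \<and> smult a f = m * q" if f: "?V f" for f
  proof -
    obtain a q where aq: "a \<noteq> 0" "smult a f = m * q + pseudo_mod f m"
      using pseudo_mod(1) m by blast
    have "int_poly_eval (smult a f) x = 0" using f by (simp add: int_poly_eval_smult)
    then have "int_poly_eval (pseudo_mod f m) x = 0"
      using aq m by (simp add: int_poly_eval_add int_poly_eval_mult)
    then have "pseudo_mod f m = 0"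
      using pseudo_mod(2)[of m f] m min[of "pseudo_mod f m"] by fastforce
    with aq show ?thesis by auto
  qed
  obtain a q where aq: "a \<noteq> 0" "smult a c = m * q" using multiple[OF cV] by blast
  obtain b r where br: "b \<noteq> 0" "smult b p = m * r" using multiple[OF pV] by blast
  have prime: "prime_elem c" using c by (rule irreducible_imp_prime_elem)
  have "c dvd m * q" using aq by (metis dvd_smult dvd_refl)
  then consider "c dvd m" | "c dvd q" using prime prime_elem_dvd_mult_iff by blast
  then show ?thesis
  proof cases
    case 1
    then have "c dvd [:b:] * p" using br by simp
    then consider "c dvd [:b:]" | "c dvd p" using prime prime_elem_dvd_mult_iff by blast
    then show ?thesis
    proof cases
      case 1
      then have "degree c = 0" using br by (metis dvd_imp_degree_le degree_pCons_0 le_zero_eq pCons_eq_0_iff)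
      then show ?thesis using not_const cV by blast
    qed
  next
    case 2
    then obtain s where "q = c * s" by (elim dvdE)
    with aq have "c * [:a:] = c * (m * s)" by (simp add: algebra_simps)
    then have "[:a:] = m * s" using cV by (metis mult_left_cancel)
    then have "degree m = 0" using aq
      by (metis dvd_imp_degree_le degree_pCons_0 le_zero_eq pCons_eq_0_iff dvd_triv_left)
    then show ?thesis using not_const m by blast
  qed
qed

lemma int_poly_eval_charpoly:
  fixes z :: "'b::field_char_0"
  shows "int_poly_eval (charpoly M) z = det (mat z - map_matrix of_int M)"
proof -
  have entry: "int_poly_eval ((if i = j then [:0, 1:] else 0) - [:M $ i $ j:]) z
      = (mat z - map_matrix of_int M) $ i $ j" for i j
    by (simp add: mat_def map_matrix_def int_poly_eval_pCons)
  show ?thesis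
    unfolding charpoly_def det_def
    by (simp add: int_poly_eval_sum int_poly_eval_mult int_poly_eval_prod int_poly_eval_of_int entry
        del: map_poly_pCons)
qed

lemma eigenvalue_imp_charpoly_root:
  fixes z :: "'b::field_char_0"
  assumes "is_eigenvalue (map_matrix of_int M) z"
  shows "int_poly_eval (charpoly M) z = 0"
proof -
  obtain x where x: "x \<noteq> 0" "map_matrix of_int M *v x = z *s x"
    using assms unfolding is_eigenvalue_def by blast
  have "mat z *v x = z *s x"
    by (simp add: matrix_vector_mult_def mat_def vec_eq_iff if_distrib[where f="\<lambda>u. u * _"] cong: if_cong)
  then have "(mat z - map_matrix of_int M) *v x = 0"
    using x by (simp add: matrix_vector_mult_diff_rdistrib)
  then have "\<not> invertible (mat z - map_matrix of_int M)"
    using x(1) by (metis invertible_left_inverse matrix_left_invertible_ker)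
  then show ?thesis
    by (simp add: int_poly_eval_charpoly invertible_det_nz)
qed

lemma pf_eigenvalue_complex:
  assumes "pf_eigenvalue M l"
  shows "is_eigenvalue (map_matrix of_int M) (of_real l :: complex)"
proof -
  obtain x :: "real ^ 'a" where x: "x \<noteq> 0" "map_matrix of_int M *v x = l *s x"
    using assms unfolding pf_eigenvalue_def is_eigenvalue_def by blast
  let ?y = "\<chi> i. complex_of_real (x $ i)"
  have "map_matrix of_int M *v ?y = of_real l *s ?y"
  proof -
    have "(\<Sum>j\<in>UNIV. complex_of_int (M $ i $ j) * of_real (x $ j)) = of_real l * of_real (x $ i)" for i
    proof -
      have "(\<Sum>j\<in>UNIV. real_of_int (M $ i $ j) * (x $ j)) = l * (x $ i)"
        using arg_cong[OF x(2), of "\<lambda>v. v $ i"]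
        by (simp add: matrix_vector_mult_def map_matrix_def)
      from arg_cong[OF this, of complex_of_real] show ?thesis by simp
    qed
    then show ?thesis by (simp add: matrix_vector_mult_def map_matrix_def vec_eq_iff)
  qed
  moreover have "?y \<noteq> 0" using x(1) by (auto simp: vec_eq_iff)
  ultimately show ?thesis unfolding is_eigenvalue_def by blast
qed

lemma pf_eigenvalue_unique:
  assumes "pf_eigenvalue M l" "pf_eigenvalue M l'"
  shows "l = l'"
proof (rule ccontr)
  assume "l \<noteq> l'"
  then have "cmod (of_real l) < l'" "cmod (of_real l') < l"
    using assms pf_eigenvalue_complex unfolding pf_eigenvalue_def by (metis of_real_eq_iff)+
  then show False by simp
qed

text \<open>
  The characteristic polynomial shares the root \<open>l\<close> with the minimal polynomial of the Pisot number
  \<open>l\<close>, so it divides that polynomial, and its remaining roots are conjugates of \<open>l\<close>.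
\<close>

lemma pisot_eigenvalue_modulus:
  fixes z :: complex
  assumes "irreducible (charpoly M)" "pf_eigenvalue M l" "pisot_number l"
    and "is_eigenvalue (map_matrix of_int M) z" "z \<noteq> of_real l"
  shows "cmod z < 1"
proof -
  obtain p :: "int poly" where p: "irreducible p" "int_poly_eval p l = 0"
    "\<And>z::complex. int_poly_eval p z = 0 \<Longrightarrow> z \<noteq> of_real l \<Longrightarrow> cmod z < 1"
    using assms(3) unfolding pisot_number_def by blast
  have "int_poly_eval (charpoly M) (complex_of_real l) = 0"
    using assms(2) by (intro eigenvalue_imp_charpoly_root pf_eigenvalue_complex)
  moreover have "int_poly_eval p (complex_of_real l) = 0"
    using p(2) by (simp add: int_poly_eval_of_real)
  ultimately have "charpoly M dvd p"
    using irreducible_int_poly_dvd_of_common_root assms(1) p(1) by blast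
  then have "int_poly_eval p z = 0"
    using eigenvalue_imp_charpoly_root[OF assms(4)] by (auto simp: int_poly_eval_mult elim!: dvdE)
  with p(3) assms(5) show ?thesis by blast
qed

section \<open>Contraction on the hyperplane\<close>

text \<open>
  The partial sums stay below the fixed point \<open>C\<close> of \<open>s \<mapsto> u 0 + r * s + suminf w\<close>.
\<close>

lemma summable_of_contractive_recursion:
  fixes u w :: "nat \<Rightarrow> real"
  assumes u: "\<And>n. 0 \<le> u n" and w: "\<And>n. 0 \<le> w n" "summable w"
    and r: "0 \<le> r" "r < 1" and rec: "\<And>n. u (Suc n) \<le> r * u n + w n"
  shows "summable u"
proof -
  define C where "C = (u 0 + suminf w) / (1 - r)"
  have C: "u 0 + r * C + suminf w = C" using r by (simp add: C_def field_simps)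
  have W: "0 \<le> suminf w" using w by (intro suminf_nonneg) auto
  have "sum u {..<n} \<le> C" for n
  proof (induction n)
    case 0
    then show ?case using W u[of 0] r by (simp add: C_def)
  next
    case (Suc n)
    have "sum u {..<Suc n} = u 0 + (\<Sum>k<n. u (Suc k))" by (rule sum.lessThan_Suc_shift)
    also have "(\<Sum>k<n. u (Suc k)) \<le> (\<Sum>k<n. r * u k + w k)" by (intro sum_mono rec)
    also have "\<dots> = r * sum u {..<n} + sum w {..<n}" by (simp add: sum.distrib sum_distrib_left)
    also have "\<dots> \<le> r * C + suminf w"
      using Suc r w by (intro add_mono mult_left_mono sum_le_suminf) auto
    finally show ?case using C by simp
  qed
  with u show ?thesis by (intro summableI_nonneg_bounded)
qed

text \<open>
  The value at the vector \<open>y\<close> of the polynomial \<open>p\<close> in the matrix \<open>A\<close>, by Horner's scheme.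
\<close>

definition poly_apply :: "'b::field ^ 'n ^ 'n \<Rightarrow> 'b poly \<Rightarrow> 'b ^ 'n \<Rightarrow> 'b ^ 'n" where
  "poly_apply A p y = fold_coeffs (\<lambda>c v. c *s y + A *v v) p 0"

lemma poly_apply_0 [simp]: "poly_apply A 0 y = 0"
  by (simp add: poly_apply_def)

lemma poly_apply_pCons [simp]: "poly_apply A (pCons c p) y = c *s y + A *v poly_apply A p y"
  by (cases "p = 0 \<and> c = 0") (auto simp: poly_apply_def)

lemma poly_apply_add: "poly_apply A (p + q) y = poly_apply A p y + poly_apply A q y"
proof (induction p arbitrary: q)
  case (pCons c p)
  then show ?case
    by (cases q) (simp add: matrix_vector_right_distrib vector_sadd_rdistrib algebra_simps)
qed simp

lemma poly_apply_smult: "poly_apply A (smult c p) y = c *s poly_apply A p y"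
  by (induction p) (simp_all add: vector_add_ldistrib vector_smult_assoc vec.scale)

lemma poly_apply_monom: "poly_apply A (monom c n) y = c *s ((*v) A ^^ n) y"
  by (induction n) (simp_all add: monom_0 monom_Suc vec.scale)

lemma poly_apply_sum: "poly_apply A (sum f S) y = (\<Sum>s\<in>S. poly_apply A (f s) y)"
  by (induction S rule: infinite_finite_induct) (simp_all add: poly_apply_add)

lemma poly_apply_linear_factor:
  "poly_apply A ([:-z, 1:] * q) y = A *v poly_apply A q y - z *s poly_apply A q y"
proof -
  have "[:-z, 1:] * q = pCons 0 q + smult (-z) q" by simp
  then show ?thesis
    by (simp only: poly_apply_add poly_apply_smult poly_apply_pCons) simp
qed

lemma poly_apply_linear_factor':
  "poly_apply A ([:-z, 1:] * q) y = poly_apply A q (A *v y - z *s y)"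
  unfolding poly_apply_linear_factor
  by (induction q) (simp_all add: vec.scale vec.diff vec.add vector_add_ldistrib vector_ssub_ldistrib
      vector_smult_assoc algebra_simps mult.commute)

lemma poly_apply_mem:
  assumes "vec.subspace W" "\<And>y. y \<in> W \<Longrightarrow> A *v y \<in> W" "y \<in> W"
  shows "poly_apply A p y \<in> W"
  using assms by (induction p) (simp_all add: vec.subspace_0 vec.subspace_add vec.subspace_scale)

text \<open>
  The vectors \<open>y, A y, A\<^sup>2 y, \<dots>\<close> are linearly dependent over the reals already.
\<close>

lemma exists_annihilating_poly:
  fixes A :: "complex ^ 'n ^ 'n"
  shows "\<exists>p. p \<noteq> 0 \<and> poly_apply A p y = 0"
proof -
  define f where "f i = ((*v) A ^^ i) y" for i :: nat
  let ?d = "DIM(complex ^ 'n)"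
  show ?thesis
  proof (cases "inj_on f {..?d}")
    case True
    then have "card (f ` {..?d}) > DIM(complex ^ 'n)" by (simp add: card_image)
    then have "dependent (f ` {..?d})" by (intro dependent_biggerset) auto
    then obtain u where u: "\<exists>v\<in>f ` {..?d}. u v \<noteq> 0" "(\<Sum>v\<in>f ` {..?d}. u v *\<^sub>R v) = 0"
      by (subst (asm) real_vector.dependent_finite) auto
    define p where "p = (\<Sum>i\<le>?d. monom (complex_of_real (u (f i))) i)"
    obtain k where k: "k \<le> ?d" "u (f k) \<noteq> 0" using u(1) by auto
    have "coeff p k = of_real (u (f k))" using k(1)
      by (simp add: p_def coeff_sum if_distrib cong: if_cong)
    with k(2) have "p \<noteq> 0" by auto
    have "poly_apply A p y = (\<Sum>i\<le>?d. u (f i) *\<^sub>R f i)"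
      unfolding p_def poly_apply_sum poly_apply_monom
      by (intro sum.cong) (simp_all add: f_def vec_eq_iff scaleR_conv_of_real[where 'a=complex])
    also have "\<dots> = 0" using u(2) True by (simp add: sum.reindex)
    finally show ?thesis using \<open>p \<noteq> 0\<close> by blast
  next
    case False
    then obtain i j where ij: "i \<noteq> j" "f i = f j" by (auto simp: inj_on_def)
    define p where "p = monom (1::complex) i + monom (-1) j"
    have "coeff p i = 1" using ij(1) by (simp add: p_def)
    then have "p \<noteq> 0" by auto
    moreover have "poly_apply A p y = 0"
      using ij(2) by (simp add: p_def poly_apply_add poly_apply_monom f_def)
    ultimately show ?thesis by blast
  qed
qed

lemma norm_vector_scalar_mult:
  fixes v :: "complex ^ 'n"
  shows "norm (z *s v) = cmod z * norm v"
  by (simp add: norm_vec_def norm_mult L2_set_right_distrib)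

text \<open>
  Split off a linear factor \<open>X - z\<close> of \<open>p\<close>. If \<open>|z| < 1\<close>, then \<open>y' = A y - z y\<close> is annihilated by the
  cofactor, and \<open>A\<^sup>n\<^sup>+\<^sup>1 y = z A\<^sup>n y + A\<^sup>n y'\<close> is a contractive recursion with summable inhomogeneity. If
  \<open>|z| \<ge> 1\<close>, then \<open>z\<close> is no eigenvalue on \<open>W\<close>, and the cofactor annihilates \<open>y\<close> already.
\<close>

lemma summable_norm_powers_of_annihilated:
  fixes A :: "complex ^ 'n ^ 'n"
  assumes W: "vec.subspace W" "\<And>y. y \<in> W \<Longrightarrow> A *v y \<in> W"
    and eig: "\<And>z y. y \<in> W \<Longrightarrow> y \<noteq> 0 \<Longrightarrow> A *v y = z *s y \<Longrightarrow> cmod z < 1"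
    and "p \<noteq> 0" "y \<in> W" "poly_apply A p y = 0"
  shows "summable (\<lambda>n. norm (((*v) A ^^ n) y))"
  using assms(4-)
proof (induction "degree p" arbitrary: p y)
  case 0
  then obtain c where c: "p = [:c:]" "c \<noteq> 0" by (metis degree_eq_zeroE pCons_0_0)
  then have "y = 0" using 0 by (simp add: vector_mul_eq_0)
  moreover have "((*v) A ^^ n) 0 = 0" for n by (induction n) auto
  ultimately show ?case by simp
next
  case (Suc d)
  have "\<not> constant (poly p)" using Suc.hyps(2) by (simp add: constant_degree)
  then obtain z where "poly p z = 0" using fundamental_theorem_of_algebra by blast
  then obtain q where q: "p = [:-z, 1:] * q" by (metis poly_eq_0_iff_dvd dvdE)
  have q0: "q \<noteq> 0" using q Suc.prems(1) by auto
  have "degree p = degree [:-z, 1:] + degree q"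
    unfolding q using q0 by (intro degree_mult_eq) auto
  then have dq: "degree q = d" using Suc.hyps(2) by simp
  show ?case
  proof (cases "cmod z < 1")
    case True
    define y' where "y' = A *v y - z *s y"
    have "y' \<in> W" using W Suc.prems(2) unfolding y'_def
      by (intro vec.subspace_diff vec.subspace_scale) auto
    moreover have "poly_apply A q y' = 0"
      using Suc.prems(3) unfolding q poly_apply_linear_factor' y'_def by simp
    ultimately have sm: "summable (\<lambda>n. norm (((*v) A ^^ n) y'))"
      using Suc.hyps(1) dq q0 by blast
    have step: "((*v) A ^^ Suc n) y = z *s ((*v) A ^^ n) y + ((*v) A ^^ n) y'" for n
      by (induction n) (simp_all add: y'_def vec.add vec.scale)
    show ?thesis
    proof (rule summable_of_contractive_recursion[OF _ _ sm norm_ge_zero True])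
      fix n
      show "norm (((*v) A ^^ Suc n) y) \<le> cmod z * norm (((*v) A ^^ n) y) + norm (((*v) A ^^ n) y')"
        unfolding step by (metis norm_triangle_ineq norm_vector_scalar_mult)
    qed auto
  next
    case False
    have "poly_apply A q y \<in> W" using W Suc.prems(2) by (rule poly_apply_mem)
    moreover have "A *v poly_apply A q y = z *s poly_apply A q y"
      using Suc.prems(3) unfolding q poly_apply_linear_factor by simp
    ultimately have "poly_apply A q y = 0" using eig False by blast
    then show ?thesis using Suc.hyps(1) dq q0 Suc.prems(2) by blast
  qed
qed

text \<open>
  Simplicity of the Perron--Frobenius eigenvalue, in the form in which it separates \<open>R\<close> from the
  hyperplane: a nonnegative eigenvector of a positive matrix with a vanishing coordinate is \<open>0\<close>, so \<open>y\<close>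
  must be a multiple of \<open>R\<close>.
\<close>

lemma pf_eigenvector_in_hyperplane_is_0:
  fixes y :: "real ^ 'n"
  assumes prim: "primitive_matrix M"
    and R: "\<And>i. 0 < R $ i" "map_matrix of_int M *v R = l *s R"
    and LR: "L \<bullet> R = 1"
    and y: "map_matrix of_int M *v y = l *s y" "L \<bullet> y = 0"
  shows "y = 0"
proof -
  let ?A = "map_matrix real_of_int M"
  obtain k where k: "\<And>i j. 0 < (((**) M ^^ k) (mat 1)) $ i $ j"
    using prim unfolding primitive_matrix_def by blast
  define K where "K = map_matrix real_of_int (((**) M ^^ k) (mat 1))"
  have Kpow: "map_matrix real_of_int (((**) M ^^ k) (mat 1)) *v v = ((*v) ?A ^^ k) v" for v k
  proof (induction k)
    case 0
    have "map_matrix real_of_int (mat 1) = (mat 1 :: real ^ 'n ^ 'n)"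
      by (simp add: map_matrix_def mat_def vec_eq_iff)
    then show ?case by simp
  next
    case (Suc k)
    have "map_matrix real_of_int (M ** N) = ?A ** map_matrix real_of_int N" for N :: "int ^ 'n ^ 'n"
      by (simp add: map_matrix_def matrix_matrix_mult_def vec_eq_iff)
    then show ?case using Suc by (simp flip: matrix_vector_mul_assoc)
  qed
  \<comment> \<open>Shift \<open>y\<close> along \<open>R\<close> until it is nonnegative with a vanishing coordinate \<open>i\<close>.\<close>
  define t where "t = Max (range (\<lambda>i. - y $ i / R $ i))"
  have "t \<in> range (\<lambda>i. - y $ i / R $ i)" unfolding t_def by (intro Max_in) auto
  then obtain i where i: "t = - y $ i / R $ i" by blast
  define z where "z = y + t *s R"
  have nn: "0 \<le> z $ j" for j
  proof -
    have "- y $ j / R $ j \<le> t" unfolding t_def by (intro Max_ge) auto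
    then show ?thesis using R(1)[of j] by (simp add: z_def field_simps)
  qed
  have zi: "z $ i = 0" using i R(1)[of i] by (simp add: z_def)
  have "?A *v z = l *s z"
    by (simp add: z_def vec.add vec.scale y(1) R(2) vector_add_ldistrib vector_smult_assoc mult.commute)
  then have "((*v) ?A ^^ k) z = (l ^ k) *s z" for k
    by (induction k) (simp_all add: vec.scale vector_smult_assoc mult.commute)
  then have "K *v z = (l ^ k) *s z" unfolding K_def Kpow by simp
  then have "(K *v z) $ i = 0" using zi by simp
  then have "(\<Sum>j\<in>UNIV. K $ i $ j * z $ j) = 0" by (simp add: matrix_vector_mult_def)
  moreover have Kp: "0 < K $ i $ j" for j using k by (simp add: K_def map_matrix_def)
  ultimately have "\<forall>j. K $ i $ j * z $ j = 0"
    using nn by (subst (asm) sum_nonneg_eq_0_iff) (auto simp: less_imp_le)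
  then have "z $ j = 0" for j using Kp[of j] by (metis less_irrefl mult_eq_0_iff)
  then have z0: "z = 0" by (simp add: vec_eq_iff)
  have "L \<bullet> z = t" by (simp add: z_def inner_add_right y(2) LR scalar_mult_eq_scaleR)
  with z0 have "t = 0" by simp
  with z0 show "y = 0" by (simp add: z_def)
qed

text \<open>
  The hyperplane is complexified to have all eigenvalues available. By simplicity \<open>l\<close> is not among
  them, so the Pisot property bounds them by \<open>1\<close>.
\<close>

lemma summable_norm_powers_on_hyperplane:
  fixes M :: "int ^ 'n ^ 'n" and L R x :: "real ^ 'n"
  defines "A \<equiv> map_matrix real_of_int M"
  assumes prim: "primitive_matrix M" and irr: "irreducible (charpoly M)"
    and l: "pf_eigenvalue M l" "pisot_number l"
    and R: "\<And>i. 0 < R $ i" "A *v R = l *s R"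
    and L: "L v* A = l *s L" and LR: "L \<bullet> R = 1" and x: "L \<bullet> x = 0"
  shows "summable (\<lambda>n. norm (((*v) A ^^ n) x))"
proof -
  define B where "B = map_matrix complex_of_int M"
  define cv where "cv v = (\<chi> i. complex_of_real (v $ i))" for v :: "real ^ 'n"
  define W where "W = {y::complex ^ 'n. (\<Sum>i\<in>UNIV. of_real (L $ i) * y $ i) = 0}"
  have Bcv: "B *v cv v = cv (A *v v)" for v
    by (simp add: A_def B_def cv_def matrix_vector_mult_def map_matrix_def vec_eq_iff)
  have ReB: "(\<chi> i. Re ((B *v y) $ i)) = A *v (\<chi> i. Re (y $ i))"
    and ImB: "(\<chi> i. Im ((B *v y) $ i)) = A *v (\<chi> i. Im (y $ i))" for y
    by (simp_all add: A_def B_def matrix_vector_mult_def map_matrix_def vec_eq_iff)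
  have Winner: "y \<in> W \<longleftrightarrow> L \<bullet> (\<chi> i. Re (y $ i)) = 0 \<and> L \<bullet> (\<chi> i. Im (y $ i)) = 0" for y
    by (simp add: W_def inner_vec_def complex_eq_iff)
  have LA: "L \<bullet> (A *v v) = l * (L \<bullet> v)" for v
    by (metis L dot_lmul_matrix inner_scaleR_left scalar_mult_eq_scaleR)
  have "vec.subspace W"
    by (auto simp: W_def vec.subspace_def algebra_simps sum.distrib simp flip: sum_distrib_left)
  moreover have "B *v y \<in> W" if "y \<in> W" for y
    using that unfolding Winner ReB ImB LA by simp
  moreover have "cmod z < 1" if "y \<in> W" "y \<noteq> 0" "B *v y = z *s y" for z y
  proof (rule pisot_eigenvalue_modulus[OF irr l])
    show "is_eigenvalue (map_matrix of_int M) z"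
      using that unfolding is_eigenvalue_def B_def by blast
    show "z \<noteq> of_real l"
    proof
      assume "z = of_real l"
      then have "A *v (\<chi> i. Re (y $ i)) = l *s (\<chi> i. Re (y $ i))"
        "A *v (\<chi> i. Im (y $ i)) = l *s (\<chi> i. Im (y $ i))"
        unfolding ReB[symmetric] ImB[symmetric] that(3) by (simp_all add: vec_eq_iff)
      then have "(\<chi> i. Re (y $ i)) = 0" "(\<chi> i. Im (y $ i)) = 0"
        using pf_eigenvector_in_hyperplane_is_0[OF prim R(1) _ LR] R(2) that(1)
        unfolding A_def Winner by blast+
      then show False using that(2) by (simp add: vec_eq_iff complex_eq_iff)
    qed
  qed
  moreover have "cv x \<in> W" using x unfolding Winner by (simp add: cv_def inner_vec_def)
  ultimately have "summable (\<lambda>n. norm (((*v) B ^^ n) (cv x)))"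
    using summable_norm_powers_of_annihilated[of W B] exists_annihilating_poly[of B "cv x"] by blast
  moreover have "((*v) B ^^ n) (cv x) = cv (((*v) A ^^ n) x)" for n
    by (induction n) (simp_all add: Bcv)
  moreover have "norm (cv v) = norm v" for v
    by (simp add: cv_def norm_vec_def)
  ultimately show ?thesis by simp
qed

section \<open>Norms on a subspace\<close>

lemma norm_on_sum:
  assumes S: "subspace S" and \<eta>: "norm_on S \<eta>" and f: "\<And>i. i \<in> I \<Longrightarrow> f i \<in> S"
  shows "\<eta> (sum f I) \<le> (\<Sum>i\<in>I. \<eta> (f i))"
proof -
  have "\<eta> 0 = 0" using \<eta> subspace_0[OF S] by (simp add: norm_on_def)
  then show ?thesis
    using f
  proof (induction I rule: infinite_finite_induct)
    case (insert i I)
    have "f i \<in> S" "sum f I \<in> S" using insert.prems S by (auto intro: subspace_sum)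
    with \<eta> have "\<eta> (f i + sum f I) \<le> \<eta> (f i) + \<eta> (sum f I)" by (auto simp: norm_on_def)
    with insert show ?case by auto
  qed auto
qed

text \<open>
  Half of the equivalence of norms in finite dimension, for norms that are given on a subspace only.
\<close>

lemma norm_on_le_norm:
  fixes S :: "'v::euclidean_space set"
  assumes S: "subspace S" and \<eta>: "norm_on S \<eta>"
  shows "\<exists>C>0. \<forall>x\<in>S. \<eta> x \<le> C * norm x"
proof -
  obtain B where B: "B \<subseteq> S" "pairwise orthogonal B" "\<And>x. x \<in> B \<Longrightarrow> norm x = 1"
    "independent B" "card B = dim S" "span B = S"
    using orthonormal_basis_subspace[OF S] by blast
  have fin: "finite B" using B(4) by (rule independent_imp_finite)
  define C where "C = (\<Sum>b\<in>B. \<eta> b) + 1"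
  have pos: "0 \<le> \<eta> x" if "x \<in> S" for x using \<eta> that by (auto simp: norm_on_def)
  have "0 \<le> (\<Sum>b\<in>B. \<eta> b)" using pos B(1) by (intro sum_nonneg) auto
  then have C: "C > 0" by (simp add: C_def)
  have "\<eta> x \<le> C * norm x" if x: "x \<in> S" for x
  proof -
    have "x = (\<Sum>b\<in>B. (b \<bullet> x) *\<^sub>R b)"
    proof -
      have "x \<in> span B" using x B(6) by simp
      then show ?thesis
        using orthonormal_basis_expand[OF B(2,3) _ fin, of x] by (simp add: inner_commute)
    qed
    then have "\<eta> x \<le> (\<Sum>b\<in>B. \<eta> ((b \<bullet> x) *\<^sub>R b))"
      using norm_on_sum[OF S \<eta>, of B "\<lambda>b. (b \<bullet> x) *\<^sub>R b"] B(1) S by (auto intro: subspace_scale)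
    also have "\<dots> = (\<Sum>b\<in>B. \<bar>b \<bullet> x\<bar> * \<eta> b)"
      using \<eta> B(1) by (intro sum.cong) (auto simp: norm_on_def)
    also have "\<dots> \<le> (\<Sum>b\<in>B. norm x * \<eta> b)"
    proof (intro sum_mono mult_right_mono)
      fix b assume "b \<in> B"
      then show "\<bar>b \<bullet> x\<bar> \<le> norm x" "0 \<le> \<eta> b"
        using Cauchy_Schwarz_ineq2[of b x] B(1,3) pos by auto
    qed
    also have "\<dots> = norm x * (\<Sum>b\<in>B. \<eta> b)" by (simp add: sum_distrib_left)
    also have "\<dots> \<le> C * norm x" by (simp add: C_def algebra_simps)
    finally show ?thesis .
  qed
  with C show ?thesis by blast
qed

section \<open>The setting\<close>

text \<open>
  The Pisot property and irreducibility enter the sequel only through \<open>summable_powers\<close>.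
\<close>

locale rauzy_setting =
  fixes \<theta> :: "'a::finite \<Rightarrow> 'a list set" and L R :: "real ^ 'a" and lam :: real
  assumes set_subst: "set_substitution \<theta>"
    and compat: "compatible \<theta>"
    and L_pos: "\<And>i. 0 < L $ i" and R_pos: "\<And>i. 0 < R $ i"
    and L_eigen: "L v* map_matrix real_of_int (subst_matrix \<theta>) = lam *s L"
    and R_eigen: "map_matrix real_of_int (subst_matrix \<theta>) *v R = lam *s R"
    and sum_R: "(\<Sum>i\<in>UNIV. R $ i) = 1" and L_R: "L \<bullet> R = 1"
    and lam_gt_1: "1 < lam"
    and summable_powers: "\<And>x. L \<bullet> x = 0 \<Longrightarrow>
      summable (\<lambda>n. norm (((*v) (map_matrix real_of_int (subst_matrix \<theta>)) ^^ n) x))"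
begin

abbreviation A :: "real ^ 'a ^ 'a" where "A \<equiv> map_matrix real_of_int (subst_matrix \<theta>)"
abbreviation Apow :: "nat \<Rightarrow> real ^ 'a \<Rightarrow> real ^ 'a" where "Apow n \<equiv> (*v) A ^^ n"
abbreviation H :: "(real ^ 'a) set" where "H \<equiv> orth_hyperplane L"
abbreviation proj :: "real ^ 'a \<Rightarrow> real ^ 'a" where "proj \<equiv> proj_along L R"

text \<open>The point of the hyperplane at which the path of a word ends.\<close>

definition pos :: "'a list \<Rightarrow> real ^ 'a" where "pos u = proj (abelianisation u)"

lemma mem_H: "x \<in> H \<longleftrightarrow> L \<bullet> x = 0"
  by (simp add: orth_hyperplane_def)

lemma subspace_H: "subspace H"
  by (simp add: subspace_def mem_H inner_add_right)

lemma closed_H: "closed H"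
  unfolding orth_hyperplane_def by (rule closed_hyperplane)

lemma L_A: "L \<bullet> (A *v v) = lam * (L \<bullet> v)"
  by (metis L_eigen dot_lmul_matrix inner_scaleR_left scalar_mult_eq_scaleR)

lemma A_in_H: "x \<in> H \<Longrightarrow> A *v x \<in> H"
  by (simp add: mem_H L_A)

lemma Apow_in_H: "x \<in> H \<Longrightarrow> Apow n x \<in> H"
  by (induction n) (auto intro: A_in_H)

lemma proj_in_H: "proj x \<in> H"
  by (simp add: mem_H proj_along_def inner_diff_right L_R)

lemma linear_proj: "linear proj"
  by (rule linearI) (simp_all add: proj_along_def inner_add_right algebra_simps)

lemma proj_A: "proj (A *v x) = A *v proj x"
  by (simp add: proj_along_def L_A R_eigen vec.diff matrix_vector_mult_scaleR
      scalar_mult_eq_scaleR mult.commute)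

lemma linear_Apow: "linear (Apow n)"
proof (induction n)
  case (Suc n)
  then show ?case using linear_compose[OF Suc matrix_vector_mul_linear[of A]] by (simp add: o_def)
qed (simp add: linear_iff)

lemma Apow_Suc': "Apow (Suc n) x = Apow n (A *v x)"
  by (simp only: funpow_Suc_right o_apply)

lemma Apow_R: "Apow n R = lam ^ n *\<^sub>R R"
  by (induction n) (simp_all add: matrix_vector_mult_scaleR R_eigen scalar_mult_eq_scaleR mult.commute)

subsection \<open>An adapted norm\<close>

text \<open>
  Summing the orbit makes \<open>A\<close> a strict contraction at once, not only in some power: one application of
  \<open>A\<close> removes the first term \<open>norm x\<close>, which is a definite proportion of the sum as all norms are
  equivalent.
\<close>

definition nrm :: "real ^ 'a \<Rightarrow> real" where "nrm x = (\<Sum>n. norm (Apow n x))"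

lemma norm_on_nrm: "norm_on H nrm"
proof -
  note sm = summable_powers[folded mem_H]
  have ge: "norm x \<le> nrm x" if "x \<in> H" for x
    using sum_le_suminf[OF sm[OF that], of "{0}"] by (simp add: nrm_def)
  have nrm0: "nrm 0 = 0"
    using linear_0[OF linear_Apow] by (simp add: nrm_def)
  show ?thesis
    unfolding norm_on_def
  proof (intro conjI ballI allI)
    fix x assume x: "x \<in> H"
    show "0 \<le> nrm x" using ge[OF x] norm_ge_zero order_trans by blast
    show "nrm x = 0 \<longleftrightarrow> x = 0" using ge[OF x] nrm0 by auto
  next
    fix c x assume x: "x \<in> H"
    show "nrm (c *\<^sub>R x) = \<bar>c\<bar> * nrm x"
      by (simp add: nrm_def linear_scale[OF linear_Apow] suminf_mult[OF sm[OF x]])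
  next
    fix x y assume x: "x \<in> H" "y \<in> H"
    have "nrm (x + y) \<le> (\<Sum>n. norm (Apow n x) + norm (Apow n y))"
      unfolding nrm_def
      using x by (intro suminf_le summable_add sm subspace_add[OF subspace_H])
        (simp_all add: linear_add[OF linear_Apow] norm_triangle_ineq)
    also have "\<dots> = nrm x + nrm y"
      using x by (simp add: nrm_def suminf_add sm)
    finally show "nrm (x + y) \<le> nrm x + nrm y" .
  qed
qed

lemma nrm_nonneg: "x \<in> H \<Longrightarrow> 0 \<le> nrm x"
  and nrm_scale: "x \<in> H \<Longrightarrow> nrm (c *\<^sub>R x) = \<bar>c\<bar> * nrm x"
  and nrm_triangle: "x \<in> H \<Longrightarrow> y \<in> H \<Longrightarrow> nrm (x + y) \<le> nrm x + nrm y"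
  and nrm_0: "nrm 0 = 0"
  using norm_on_nrm subspace_0[OF subspace_H] by (auto simp: norm_on_def)

lemma nrm_A: "x \<in> H \<Longrightarrow> nrm (A *v x) = nrm x - norm x"
  using suminf_split_head[of "\<lambda>n. norm (Apow n x)"] summable_powers
  by (simp add: nrm_def mem_H Apow_Suc'[unfolded funpow.simps o_apply])

lemma norm_le_nrm: "x \<in> H \<Longrightarrow> norm x \<le> nrm x"
  using nrm_nonneg[OF A_in_H] nrm_A by force

lemma nrm_le_norm: "\<exists>C>0. \<forall>x\<in>H. nrm x \<le> C * norm x"
  by (rule norm_on_le_norm[OF subspace_H norm_on_nrm])

definition rho :: real where
  "rho = (SOME r. 0 \<le> r \<and> r < 1 \<and> (\<forall>x\<in>H. nrm (A *v x) \<le> r * nrm x))"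

lemma rho: "0 \<le> rho" "rho < 1" "x \<in> H \<Longrightarrow> nrm (A *v x) \<le> rho * nrm x"
proof -
  obtain C where C: "C > 0" "\<And>x. x \<in> H \<Longrightarrow> nrm x \<le> C * norm x" using nrm_le_norm by blast
  have "nrm (A *v x) \<le> (1 - 1 / max C 1) * nrm x" if x: "x \<in> H" for x
  proof -
    have "nrm x \<le> max C 1 * norm x" using C(2)[OF x] by (smt (verit) mult_right_mono norm_ge_zero)
    then have "nrm x / max C 1 \<le> norm x" by (simp add: field_simps)
    then show ?thesis using nrm_A[OF x] by (simp add: left_diff_distrib)
  qed
  then have "\<exists>r. 0 \<le> r \<and> r < 1 \<and> (\<forall>x\<in>H. nrm (A *v x) \<le> r * nrm x)"
    by (intro exI[of _ "1 - 1 / max C 1"]) (auto simp: field_simps)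
  from someI_ex[OF this] show "0 \<le> rho" "rho < 1" "x \<in> H \<Longrightarrow> nrm (A *v x) \<le> rho * nrm x"
    unfolding rho_def by auto
qed

lemma nrm_Apow: "x \<in> H \<Longrightarrow> nrm (Apow n x) \<le> rho ^ n * nrm x"
proof (induction n)
  case (Suc n)
  have "nrm (Apow (Suc n) x) \<le> rho * nrm (Apow n x)" using rho(3) Suc.prems Apow_in_H by simp
  also have "\<dots> \<le> rho * (rho ^ n * nrm x)" using Suc rho(1) by (intro mult_left_mono) auto
  finally show ?case by simp
qed simp

lemma Apow_tendsto_0: "x \<in> H \<Longrightarrow> (\<lambda>n. Apow n x) \<longlonglongrightarrow> 0"
  using summable_LIMSEQ_zero[OF summable_powers] by (simp add: mem_H tendsto_norm_zero_iff)

subsection \<open>Positions\<close>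

lemma abelianisation_append: "abelianisation (u @ v) = abelianisation u + abelianisation v"
  by (simp add: abelianisation_def vec_eq_iff)

lemma abelianisation_Nil: "abelianisation [] = 0"
  by (simp add: abelianisation_def vec_eq_iff)

text \<open>Compatibility: the counts in an image do not depend on the realisation.\<close>

lemma abelianisation_image:
  assumes "u \<in> \<theta> c"
  shows "abelianisation u = A *v abelianisation [c]"
proof -
  have "(SOME v. v \<in> \<theta> c) \<in> \<theta> c" using assms by (rule someI)
  then have "abelianisation u = abelianisation (SOME v. v \<in> \<theta> c)"
    using compat assms unfolding compatible_def by blast
  then show ?thesis
    by (simp add: abelianisation_def vec_eq_iff matrix_vector_mult_def map_matrix_def subst_matrix_def
        if_distrib[where f=real] if_distrib[where f="\<lambda>x. _ * x"] cong: if_cong)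
qed

lemma inner_abelianisation_single: "v \<bullet> abelianisation [c] = v $ c"
  by (simp add: abelianisation_def inner_vec_def if_distrib[where f=real]
      if_distrib[where f="\<lambda>x. _ * x"] cong: if_cong)

lemma L_abelianisation_image: "u \<in> \<theta> c \<Longrightarrow> L \<bullet> abelianisation u = lam * L $ c"
  by (simp add: abelianisation_image L_A inner_abelianisation_single)

lemma L_abelianisation: "L \<bullet> abelianisation u = (\<Sum>j<length u. L $ (u ! j))"
proof (induction u rule: rev_induct)
  case (snoc c u)
  have "(\<Sum>j<length u. L $ ((u @ [c]) ! j)) = (\<Sum>j<length u. L $ (u ! j))"
    by (intro sum.cong) (auto simp: nth_append)
  with snoc show ?case
    by (simp add: abelianisation_append inner_add_right inner_abelianisation_single)
qed (simp add: abelianisation_Nil)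

lemma pos_append: "pos (u @ v) = pos u + pos v"
  by (simp add: pos_def abelianisation_append linear_add[OF linear_proj])

lemma pos_Nil [simp]: "pos [] = 0"
  by (simp add: pos_def abelianisation_Nil linear_0[OF linear_proj])

lemma pos_in_H: "pos u \<in> H"
  by (simp add: pos_def proj_in_H)

lemma pos_image: "u \<in> \<theta> c \<Longrightarrow> pos u = A *v pos [c]"
  by (simp add: pos_def abelianisation_image proj_A)

lemma finite_theta [simp, intro]: "finite (\<theta> c)"
  using set_subst by (simp add: set_substitution_def)

text \<open>
  The geometric series \<open>\<Sum>\<^sub>k \<rho>\<^sup>k t\<close>, where \<open>t\<close> bounds the norm of every proper prefix of an image. Balls
  of at least this radius are mapped into themselves by all \<open>x \<mapsto> A x + pos (take j u)\<close>.
\<close>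

definition radius :: real where
  "radius = (\<Sum>c\<in>UNIV. \<Sum>u\<in>\<theta> c. \<Sum>j<length u. nrm (pos (take j u))) / (1 - rho)"

definition region :: "real \<Rightarrow> (real ^ 'a) set" where
  "region B = {x \<in> H. nrm x \<le> B}"

lemma nrm_displacement:
  assumes "u \<in> \<theta> c" "j < length u"
  shows "nrm (pos (take j u)) \<le> (1 - rho) * radius"
proof -
  have nn: "0 \<le> nrm (pos v)" for v by (intro nrm_nonneg pos_in_H)
  have "nrm (pos (take j u)) \<le> (\<Sum>j<length u. nrm (pos (take j u)))"
    using assms nn by (intro member_le_sum[of j "{..<length u}" "\<lambda>j. nrm (pos (take j u))"]) auto
  also have "\<dots> \<le> (\<Sum>u\<in>\<theta> c. \<Sum>j<length u. nrm (pos (take j u)))"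
    using assms nn by (intro member_le_sum[of u "\<theta> c" "\<lambda>u. \<Sum>j<length u. nrm (pos (take j u))"])
      (auto intro: sum_nonneg)
  also have "\<dots> \<le> (\<Sum>c\<in>UNIV. \<Sum>u\<in>\<theta> c. \<Sum>j<length u. nrm (pos (take j u)))"
    using nn by (intro member_le_sum[of c UNIV "\<lambda>c. \<Sum>u\<in>\<theta> c. \<Sum>j<length u. nrm (pos (take j u))"])
      (auto intro!: sum_nonneg)
  also have "\<dots> = (1 - rho) * radius" using rho(2) by (simp add: radius_def)
  finally show ?thesis .
qed

lemma radius_nonneg: "0 \<le> radius"
  unfolding radius_def using rho(2)
  by (intro divide_nonneg_nonneg sum_nonneg nrm_nonneg pos_in_H) auto

lemma zero_in_region: "0 \<le> B \<Longrightarrow> 0 \<in> region B"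
  by (simp add: region_def mem_H nrm_0)

lemma region_invariant:
  assumes "radius \<le> B" "x \<in> region B" "nrm t \<le> (1 - rho) * radius" "t \<in> H"
  shows "A *v x + t \<in> region B"
proof -
  have x: "x \<in> H" "nrm x \<le> B" using assms by (auto simp: region_def)
  have "nrm (A *v x + t) \<le> nrm (A *v x) + nrm t"
    using x assms by (intro nrm_triangle A_in_H)
  also have "\<dots> \<le> rho * B + (1 - rho) * B"
  proof (intro add_mono)
    have "nrm (A *v x) \<le> rho * nrm x" by (rule rho(3)[OF x(1)])
    also have "\<dots> \<le> rho * B" using x rho by (intro mult_left_mono)
    finally show "nrm (A *v x) \<le> rho * B" .
    have "(1 - rho) * radius \<le> (1 - rho) * B" using assms(1) rho by (intro mult_left_mono) auto
    with assms(3) show "nrm t \<le> (1 - rho) * B" by linarith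
  qed
  finally have "nrm (A *v x + t) \<le> B" by (simp add: algebra_simps)
  then show ?thesis
    using x assms(4) A_in_H subspace_add[OF subspace_H] by (simp add: region_def)
qed

lemma region_step:
  assumes "radius \<le> B" "x \<in> region B" "u \<in> \<theta> c" "j < length u"
  shows "A *v x + pos (take j u) \<in> region B"
  using assms nrm_displacement pos_in_H by (intro region_invariant)

end

context rauzy_setting
begin

section \<open>The transfer operator\<close>

text \<open>
  The sum of a family of functions along the path of a word started at \<open>x\<close>: the function belonging to
  each letter is evaluated at the point of the path just before this letter.
\<close>

primrec path_sum :: "('a \<Rightarrow> real ^ 'a \<Rightarrow> real) \<Rightarrow> real ^ 'a \<Rightarrow> 'a list \<Rightarrow> real" where
  "path_sum G x [] = 0"
| "path_sum G x (i # w) = G i x + path_sum G (x + pos [i]) w"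

lemma pos_Cons: "pos (i # v) = pos [i] + pos v"
  using pos_append[of "[i]" v] by simp

lemma path_sum_append: "path_sum G x (u @ v) = path_sum G x u + path_sum G (x + pos u) v"
proof (induction u arbitrary: x)
  case (Cons i u)
  then show ?case by (simp add: pos_Cons[of i u] add.assoc)
qed simp

lemma path_sum_eq: "path_sum G x w = (\<Sum>j<length w. G (w ! j) (x + pos (take j w)))"
proof (induction w arbitrary: x)
  case (Cons i w)
  show ?case
    by (simp add: Cons sum.lessThan_Suc_shift add.assoc pos_Cons[of i "take _ w"] del: sum.lessThan_Suc)
qed simp

text \<open>
  The mean path sum of a random image of the letter \<open>c\<close> whose path starts at \<open>A x\<close>. This is the dual of
  the action of the random substitution on vectors of measures.
\<close>

definition transfer ::
    "('a \<Rightarrow> 'a list \<Rightarrow> real) \<Rightarrow> ('a \<Rightarrow> real ^ 'a \<Rightarrow> real) \<Rightarrow> 'a \<Rightarrow> real ^ 'a \<Rightarrow> real" where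
  "transfer P G c x = (\<Sum>u\<in>\<theta> c. P c u * path_sum G (A *v x) u)"

lemma prob_choicesD:
  assumes "P \<in> prob_choices \<theta>"
  shows "0 \<le> P c u" "u \<notin> \<theta> c \<Longrightarrow> P c u = 0" "(\<Sum>u\<in>\<theta> c. P c u) = 1"
    "u \<in> \<theta> c \<Longrightarrow> 0 < P c u"
proof -
  have *: "\<And>v. v \<in> \<theta> c \<Longrightarrow> 0 < P c v" "\<And>v. v \<notin> \<theta> c \<Longrightarrow> P c v = 0" "(\<Sum>u\<in>\<theta> c. P c u) = 1"
    using assms by (auto simp: prob_choices_def)
  from * show "u \<notin> \<theta> c \<Longrightarrow> P c u = 0" "(\<Sum>u\<in>\<theta> c. P c u) = 1" "u \<in> \<theta> c \<Longrightarrow> 0 < P c u"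
    by auto
  from * show "0 \<le> P c u" by (cases "u \<in> \<theta> c") (auto simp: less_imp_le)
qed

lemma pmf_letter_image:
  assumes "P \<in> prob_choices \<theta>"
  shows "pmf (embed_pmf (P c)) = P c" "set_pmf (embed_pmf (P c)) = \<theta> c"
proof -
  note P = prob_choicesD[OF assms]
  have "(\<integral>\<^sup>+ u. ennreal (P c u) \<partial>count_space UNIV) = (\<Sum>u\<in>\<theta> c. ennreal (P c u))"
    using P(2) by (intro nn_integral_count_space') (auto intro: ccontr)
  also have "\<dots> = 1" using P(1,3) by simp
  finally have 1: "(\<integral>\<^sup>+ u. ennreal (P c u) \<partial>count_space UNIV) = 1" .
  show "pmf (embed_pmf (P c)) = P c" by (rule ext) (rule pmf_embed_pmf[OF P(1) 1])
  show "set_pmf (embed_pmf (P c)) = \<theta> c"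
    using set_embed_pmf[OF P(1) 1] P(2,4) by force
qed

lemma finite_set_pmf_random_image:
  assumes P: "P \<in> prob_choices \<theta>"
  shows "finite (set_pmf (random_image P w))"
  by (induction w) (auto simp: pmf_letter_image[OF P])

lemma abelianisation_random_image:
  assumes P: "P \<in> prob_choices \<theta>" and u: "u \<in> set_pmf (random_image P w)"
  shows "abelianisation u = A *v abelianisation w"
  using u
proof (induction w arbitrary: u)
  case (Cons i w)
  then obtain v z where "v \<in> \<theta> i" "z \<in> set_pmf (random_image P w)" "u = v @ z"
    by (auto simp: pmf_letter_image[OF P])
  then show ?case
    using Cons.IH[of z] abelianisation_append[of "[i]" w]
    by (simp add: abelianisation_append abelianisation_image[of v i] vec.add)
qed (simp add: abelianisation_Nil)

lemma finite_set_pmf_random_iterate: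
  assumes P: "P \<in> prob_choices \<theta>"
  shows "finite (set_pmf (random_iterate P n v))"
  by (induction n) (auto simp: finite_set_pmf_random_image[OF P])

lemma abelianisation_random_iterate:
  assumes P: "P \<in> prob_choices \<theta>" and u: "u \<in> set_pmf (random_iterate P n v)"
  shows "abelianisation u = Apow n (abelianisation v)"
  using u
proof (induction n arbitrary: u)
  case (Suc n)
  then obtain w where "w \<in> set_pmf (random_iterate P n v)" "u \<in> set_pmf (random_image P w)"
    by auto
  then show ?case using abelianisation_random_image[OF P] Suc.IH by simp
qed simp

text \<open>
  If the path of \<open>w\<close> visits \<open>x\<close>, the path of every realisation visits \<open>A x\<close>; so the images of the single
  letters can be averaged separately.
\<close>

lemma expectation_random_image:
  assumes P: "P \<in> prob_choices \<theta>"
  shows "measure_pmf.expectation (random_image P w) (path_sum G (A *v x)) = path_sum (transfer P G) x w"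
proof (induction w arbitrary: x)
  case (Cons i w)
  let ?E = "\<lambda>y. measure_pmf.expectation (random_image P w) (path_sum G y)"
  have "measure_pmf.expectation (random_image P (i # w)) (path_sum G (A *v x))
      = (\<Sum>u\<in>\<theta> i. P i u * measure_pmf.expectation (map_pmf ((@) u) (random_image P w)) (path_sum G (A *v x)))"
    by (simp add: pmf_expectation_bind[of "\<theta> i"] pmf_letter_image[OF P] finite_set_pmf_random_image[OF P])
  also have "\<dots> = (\<Sum>u\<in>\<theta> i. P i u * (path_sum G (A *v x) u + path_sum (transfer P G) (x + pos [i]) w))"
  proof (intro sum.cong refl arg_cong2[where f = "(*)"])
    fix u assume u: "u \<in> \<theta> i"
    have "measure_pmf.expectation (map_pmf ((@) u) (random_image P w)) (path_sum G (A *v x))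
        = measure_pmf.expectation (random_image P w)
            (\<lambda>z. path_sum G (A *v x) u + path_sum G (A *v x + pos u) z)"
      by (simp add: path_sum_append)
    also have "\<dots> = path_sum G (A *v x) u + ?E (A *v x + pos u)"
      using finite_set_pmf_random_image[OF P]
      by (subst Bochner_Integration.integral_add) (auto intro: integrable_measure_pmf_finite)
    also have "A *v x + pos u = A *v (x + pos [i])"
      by (simp add: pos_image[OF u] vec.add)
    finally show "measure_pmf.expectation (map_pmf ((@) u) (random_image P w)) (path_sum G (A *v x))
        = path_sum G (A *v x) u + path_sum (transfer P G) (x + pos [i]) w"
      by (simp add: Cons)
  qed
  also have "\<dots> = transfer P G i x + (\<Sum>u\<in>\<theta> i. P i u) * path_sum (transfer P G) (x + pos [i]) w"
    by (simp add: transfer_def distrib_left sum.distrib sum_distrib_right)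
  finally show ?case by (simp add: prob_choicesD[OF P])
qed simp

text \<open>
  The last step of the Markov chain, which is the finest level of the hierarchy, is peeled off first
  and moved into the test functions.
\<close>

lemma expectation_random_iterate:
  assumes P: "P \<in> prob_choices \<theta>"
  shows "measure_pmf.expectation (random_iterate P n v) (path_sum G 0)
    = path_sum ((transfer P ^^ n) G) 0 v"
proof (induction n arbitrary: G)
  case (Suc n)
  let ?S = "set_pmf (random_iterate P n v)"
  have fin: "finite ?S" by (rule finite_set_pmf_random_iterate[OF P])
  have "measure_pmf.expectation (random_iterate P (Suc n) v) (path_sum G 0)
      = (\<Sum>w\<in>?S. pmf (random_iterate P n v) w *
          measure_pmf.expectation (random_image P w) (path_sum G (A *v 0)))"
    by (simp add: pmf_expectation_bind[of ?S] fin finite_set_pmf_random_image[OF P])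
  also have "\<dots> = measure_pmf.expectation (random_iterate P n v) (path_sum (transfer P G) 0)"
    unfolding expectation_random_image[OF P] using fin by (subst integral_measure_pmf[of ?S]) auto
  also have "\<dots> = path_sum ((transfer P ^^ n) (transfer P G)) 0 v" by (rule Suc)
  finally show ?case by (simp only: funpow_Suc_right o_apply)
qed simp

subsection \<open>Estimates\<close>

text \<open>
  Errors are measured in multiples of \<open>L\<close>: as \<open>L\<close> is a left eigenvector, an error bounded by \<open>L\<close>
  grows under the transfer operator by the factor \<open>\<lambda>\<close> exactly, without further constants.
\<close>

lemma path_sum_diff_le:
  assumes "\<And>j. j < length w \<Longrightarrow>
    \<bar>G (w ! j) (x + pos (take j w)) - F (w ! j) (y + pos (take j w))\<bar> \<le> \<epsilon> * L $ (w ! j)"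
  shows "\<bar>path_sum G x w - path_sum F y w\<bar> \<le> \<epsilon> * (L \<bullet> abelianisation w)"
proof -
  have "\<bar>path_sum G x w - path_sum F y w\<bar>
      \<le> (\<Sum>j<length w. \<bar>G (w ! j) (x + pos (take j w)) - F (w ! j) (y + pos (take j w))\<bar>)"
    unfolding path_sum_eq sum_subtractf[symmetric] by (rule sum_abs)
  also have "\<dots> \<le> (\<Sum>j<length w. \<epsilon> * L $ (w ! j))" using assms by (intro sum_mono) auto
  finally show ?thesis by (simp add: L_abelianisation sum_distrib_left)
qed

lemma transfer_diff_le:
  assumes P: "P \<in> prob_choices \<theta>"
    and le: "\<And>u j. u \<in> \<theta> c \<Longrightarrow> j < length u \<Longrightarrow>
      \<bar>G (u ! j) (A *v x + pos (take j u)) - F (u ! j) (A *v y + pos (take j u))\<bar> \<le> \<epsilon> * L $ (u ! j)"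
  shows "\<bar>transfer P G c x - transfer P F c y\<bar> \<le> \<epsilon> * lam * L $ c"
proof -
  have "\<bar>transfer P G c x - transfer P F c y\<bar>
      \<le> (\<Sum>u\<in>\<theta> c. \<bar>P c u * (path_sum G (A *v x) u - path_sum F (A *v y) u)\<bar>)"
    unfolding transfer_def sum_subtractf[symmetric] right_diff_distrib[symmetric] by (rule sum_abs)
  also have "\<dots> \<le> (\<Sum>u\<in>\<theta> c. P c u * (\<epsilon> * (lam * L $ c)))"
  proof (intro sum_mono)
    fix u assume u: "u \<in> \<theta> c"
    have "\<bar>path_sum G (A *v x) u - path_sum F (A *v y) u\<bar> \<le> \<epsilon> * (L \<bullet> abelianisation u)"
      using le[OF u] by (rule path_sum_diff_le)
    then show "\<bar>P c u * (path_sum G (A *v x) u - path_sum F (A *v y) u)\<bar> \<le> P c u * (\<epsilon> * (lam * L $ c))"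
      using prob_choicesD(1)[OF P, of c u] L_abelianisation_image[OF u]
      by (simp add: abs_mult mult_left_mono)
  qed
  also have "\<dots> = \<epsilon> * lam * L $ c"
    using prob_choicesD(3)[OF P, of c] by (simp flip: sum_distrib_right)
  finally show ?thesis .
qed

text \<open>
  The two sides of the difference evaluate \<open>G\<close> and \<open>F\<close> at the same number of points, and matching points
  differ by \<open>A\<^sup>n (x - y)\<close>. Two cases matter: \<open>F = G\<close>, where the contraction makes the difference small,
  and \<open>x = y\<close>, which compares different families.
\<close>

lemma transfer_pow_diff_le:
  assumes P: "P \<in> prob_choices \<theta>" and B: "radius \<le> B"
    and le: "\<And>a x' y'. x' \<in> region B \<Longrightarrow> y' \<in> region B \<Longrightarrow> x' - y' = Apow n (x - y) \<Longrightarrow>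
      \<bar>G a x' - F a y'\<bar> \<le> \<epsilon> * L $ a"
    and xy: "x \<in> region B" "y \<in> region B"
  shows "\<bar>(transfer P ^^ n) G c x - (transfer P ^^ n) F c y\<bar> \<le> \<epsilon> * lam ^ n * L $ c"
  using xy le
proof (induction n arbitrary: x y c)
  case (Suc n)
  have "\<bar>transfer P ((transfer P ^^ n) G) c x - transfer P ((transfer P ^^ n) F) c y\<bar>
      \<le> (\<epsilon> * lam ^ n) * lam * L $ c"
  proof (rule transfer_diff_le[OF P])
    fix u j assume u: "u \<in> \<theta> c" "j < length u"
    let ?x = "A *v x + pos (take j u)" and ?y = "A *v y + pos (take j u)"
    have "?x - ?y = A *v (x - y)" by (simp add: vec.diff)
    then have "Apow n (?x - ?y) = Apow (Suc n) (x - y)" by (simp only: Apow_Suc')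
    then show "\<bar>(transfer P ^^ n) G (u ! j) ?x - (transfer P ^^ n) F (u ! j) ?y\<bar> \<le> \<epsilon> * lam ^ n * L $ (u ! j)"
      using Suc.prems(3) by (intro Suc.IH region_step[OF B _ u] Suc.prems(1,2)) simp
  qed
  then show ?case by (simp add: mult_ac)
qed (use le in simp)

lemma path_sum_const: "path_sum (\<lambda>a _. v \<bullet> Apow m (abelianisation [a])) x u = v \<bullet> Apow m (abelianisation u)"
proof (induction u arbitrary: x)
  case (Cons i u)
  then show ?case using abelianisation_append[of "[i]" u]
    by (simp add: linear_add[OF linear_Apow] inner_add_right)
qed (simp add: abelianisation_Nil linear_0[OF linear_Apow])

text \<open>On families of constant functions the transfer operator is the transpose of \<open>A\<close>.\<close>

lemma transfer_pow_const:
  assumes P: "P \<in> prob_choices \<theta>"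
  shows "(transfer P ^^ m) (\<lambda>a _. v $ a) = (\<lambda>c _. v \<bullet> Apow m (abelianisation [c]))"
proof (induction m)
  case 0
  show ?case by (simp add: inner_abelianisation_single)
next
  case (Suc m)
  have "transfer P (\<lambda>c _. v \<bullet> Apow m (abelianisation [c])) c x = v \<bullet> Apow (Suc m) (abelianisation [c])" for c x
  proof -
    have "transfer P (\<lambda>c _. v \<bullet> Apow m (abelianisation [c])) c x
        = (\<Sum>u\<in>\<theta> c. P c u * (v \<bullet> Apow m (A *v abelianisation [c])))"
      unfolding transfer_def path_sum_const by (intro sum.cong) (auto simp: abelianisation_image)
    then show ?thesis
      unfolding Apow_Suc' by (simp add: prob_choicesD[OF P] flip: sum_distrib_right)
  qed
  then show ?case unfolding funpow.simps(2)[of m "transfer P"] o_apply Suc by blast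
qed

text \<open>The Perron--Frobenius limit; on the hyperplane already the unscaled powers tend to \<open>0\<close>.\<close>

lemma Apow_scaled_tendsto: "(\<lambda>m. Apow m x /\<^sub>R lam ^ m) \<longlonglongrightarrow> (L \<bullet> x) *\<^sub>R R"
proof -
  have "x = (L \<bullet> x) *\<^sub>R R + proj x" by (simp add: proj_along_def)
  then have "Apow m x = (L \<bullet> x) *\<^sub>R lam ^ m *\<^sub>R R + Apow m (proj x)" for m
    by (metis linear_add[OF linear_Apow] linear_scale[OF linear_Apow] Apow_R)
  then have eq: "Apow m x /\<^sub>R lam ^ m = (L \<bullet> x) *\<^sub>R R + Apow m (proj x) /\<^sub>R lam ^ m" for m
    using lam_gt_1 by (simp add: scaleR_add_right)
  have "(\<lambda>m. inverse (lam ^ m)) \<longlonglongrightarrow> 0" using LIMSEQ_inverse_realpow_zero[OF lam_gt_1] .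
  from tendsto_scaleR[OF this Apow_tendsto_0[OF proj_in_H]]
  have "(\<lambda>m. (L \<bullet> x) *\<^sub>R R + Apow m (proj x) /\<^sub>R lam ^ m) \<longlonglongrightarrow> (L \<bullet> x) *\<^sub>R R + 0"
    by (intro tendsto_add tendsto_const) simp
  then show ?thesis unfolding eq by simp
qed

lemma continuous_on_transfer:
  assumes "\<And>a. continuous_on H (G a)"
  shows "continuous_on H (transfer P G c)"
proof -
  have "continuous_on H (\<lambda>x. G i (A *v x + pos w))" for i w
  proof (rule continuous_on_compose2[OF assms])
    show "continuous_on H (\<lambda>x. A *v x + pos w)"
      by (intro continuous_intros linear_continuous_on_compose[OF continuous_on_id] matrix_vector_mul_linear)
    show "(\<lambda>x. A *v x + pos w) ` H \<subseteq> H"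
      using A_in_H pos_in_H subspace_add[OF subspace_H] by blast
  qed
  then show ?thesis unfolding transfer_def path_sum_eq by (intro continuous_intros)
qed

lemma continuous_on_transfer_pow:
  assumes "\<And>a. continuous_on H (G a)"
  shows "continuous_on H ((transfer P ^^ n) G c)"
  by (induction n arbitrary: c) (simp_all add: assms continuous_on_transfer)

lemma tendsto_coordinates:
  fixes P :: "'a \<Rightarrow> 'a list \<Rightarrow> real"
  assumes "((\<lambda>Q. Q) \<longlongrightarrow> P) F"
  shows "((\<lambda>Q. Q c u) \<longlongrightarrow> P c u) F"
proof -
  have "((\<lambda>Q. Q c) \<longlongrightarrow> P c) F"
    by (rule continuous_on_tendsto_compose[OF continuous_on_product_coordinates assms]) auto
  then show ?thesis
    by (rule continuous_on_tendsto_compose[OF continuous_on_product_coordinates]) auto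
qed

lemma transfer_pow_tendsto_prob:
  assumes "((\<lambda>Q. Q) \<longlongrightarrow> P) F"
  shows "((\<lambda>Q. (transfer Q ^^ n) G c x) \<longlongrightarrow> (transfer P ^^ n) G c x) F"
proof (induction n arbitrary: c x)
  case (Suc n)
  have "((\<lambda>Q. Q c u) \<longlongrightarrow> P c u) F" for c u by (rule tendsto_coordinates[OF assms])
  then show ?case
    unfolding funpow.simps o_apply transfer_def[of _ "(transfer _ ^^ n) G" c x] path_sum_eq
    by (intro tendsto_intros Suc)
qed simp

end

section \<open>Random addresses\<close>

text \<open>The version of \<open>nn_integral_stream_space\<close> for bounded real functions.\<close>

lemma (in prob_space) integral_stream_space:
  fixes f :: "'a stream \<Rightarrow> real"
  assumes f[measurable]: "f \<in> borel_measurable (stream_space M)" and bound: "\<And>\<omega>. \<bar>f \<omega>\<bar> \<le> C"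
  shows "(\<integral>\<omega>. f \<omega> \<partial>stream_space M) = (\<integral>x. \<integral>\<omega>. f (x ## \<omega>) \<partial>stream_space M \<partial>M)"
proof -
  interpret S: prob_space "stream_space M" by (rule prob_space_stream_space)
  interpret P: pair_prob_space M "stream_space M" ..
  let ?c = "\<lambda>(x, \<omega>). x ## \<omega>"
  have c[measurable]: "?c \<in> M \<Otimes>\<^sub>M stream_space M \<rightarrow>\<^sub>M stream_space M" by measurable
  have "stream_space M = distr (M \<Otimes>\<^sub>M stream_space M) (stream_space M) ?c"
  proof (rule measure_eqI)
    fix X assume "X \<in> sets (stream_space M)"
    then have X[measurable]: "X \<in> sets (stream_space M)" .
    have "emeasure (stream_space M) X = (\<integral>\<^sup>+ \<omega>. indicator X \<omega> \<partial>stream_space M)" by simp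
    also have "\<dots> = (\<integral>\<^sup>+ x. \<integral>\<^sup>+ \<omega>. indicator X (x ## \<omega>) \<partial>stream_space M \<partial>M)"
      by (rule nn_integral_stream_space) measurable
    also have "\<dots> = (\<integral>\<^sup>+ z. indicator X (?c z) \<partial>(M \<Otimes>\<^sub>M stream_space M))"
      by (subst S.nn_integral_fst[symmetric]) simp_all
    also have "\<dots> = (\<integral>\<^sup>+ \<omega>. indicator X \<omega> \<partial>distr (M \<Otimes>\<^sub>M stream_space M) (stream_space M) ?c)"
      by (rule nn_integral_distr[symmetric]) measurable
    also have "\<dots> = emeasure (distr (M \<Otimes>\<^sub>M stream_space M) (stream_space M) ?c) X" by simp
    finally show "emeasure (stream_space M) X = emeasure (distr (M \<Otimes>\<^sub>M stream_space M) (stream_space M) ?c) X" .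
  qed simp
  then have "(\<integral>\<omega>. f \<omega> \<partial>stream_space M) = (\<integral>z. f (?c z) \<partial>(M \<Otimes>\<^sub>M stream_space M))"
    by (metis integral_distr[OF c f])
  also have "\<dots> = (\<integral>x. \<integral>\<omega>. f (?c (x, \<omega>)) \<partial>stream_space M \<partial>M)"
  proof (rule P.integral_fst'[symmetric])
    show "integrable (M \<Otimes>\<^sub>M stream_space M) (\<lambda>z. f (?c z))"
      using bound by (intro P.integrable_const_bound[of _ C]) auto
  qed
  finally show ?thesis by simp
qed

context rauzy_setting
begin

subsection \<open>The chain of ancestors\<close>

text \<open>
  The element \<open>(c, u, j)\<close> stands for the position \<open>j\<close> in the image \<open>u\<close> of the letter \<open>c\<close>.
\<close>

definition steps :: "('a \<times> 'a list \<times> nat) set" where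
  "steps = (SIGMA c:UNIV. SIGMA u:\<theta> c. {..<length u})"

text \<open>
  The conditional probability that a letter \<open>a\<close> deep in the hierarchy is the letter at position \<open>j\<close> of
  the image \<open>u\<close> of a letter \<open>c\<close>: letters \<open>c\<close> have frequency \<open>R $ c\<close>, and one level down each of them is
  spread over \<open>\<lambda>\<close> letters on average.
\<close>

definition step_weight :: "('a \<Rightarrow> 'a list \<Rightarrow> real) \<Rightarrow> 'a \<Rightarrow> 'a \<times> 'a list \<times> nat \<Rightarrow> real" where
  "step_weight P a = (\<lambda>(c, u, j).
    if (c, u, j) \<in> steps \<and> u ! j = a then R $ c * P c u / (lam * R $ a) else 0)"

definition step_pmf :: "('a \<Rightarrow> 'a list \<Rightarrow> real) \<Rightarrow> 'a \<Rightarrow> ('a \<times> 'a list \<times> nat) pmf" where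
  "step_pmf P a = embed_pmf (step_weight P a)"

lemma finite_steps [simp]: "finite steps"
  unfolding steps_def by (intro finite_SigmaI) auto

lemma sum_steps: "(\<Sum>s\<in>steps. f s) = (\<Sum>c\<in>UNIV. \<Sum>u\<in>\<theta> c. \<Sum>j<length u. f (c, u, j))"
proof -
  have "(\<Sum>c\<in>UNIV. \<Sum>u\<in>\<theta> c. \<Sum>j<length u. f (c, u, j))
      = (\<Sum>c\<in>UNIV. \<Sum>p\<in>Sigma (\<theta> c) (\<lambda>u. {..<length u}). f (c, p))"
    by (intro sum.cong refl) (simp add: sum.Sigma split_beta)
  also have "\<dots> = (\<Sum>s\<in>steps. f s)"
    unfolding steps_def by (subst sum.Sigma) (simp_all add: split_beta)
  finally show ?thesis ..
qed

lemma path_sum_letter: "path_sum (\<lambda>b _. if b = a then 1 else 0) x u = abelianisation u $ a"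
  by (induction u arbitrary: x) (simp_all add: abelianisation_def)

lemma sum_letter:
  "(\<Sum>j<length u. if u ! j = a then 1 else 0) = abelianisation u $ a" for u :: "'a list"
  using path_sum_letter[of a 0 u] by (simp add: path_sum_eq)

text \<open>The weights add up to \<open>1\<close> because \<open>R\<close> is a right eigenvector.\<close>

lemma pmf_step_pmf:
  assumes P: "P \<in> prob_choices \<theta>"
  shows "pmf (step_pmf P a) = step_weight P a"
proof -
  have nonneg: "0 \<le> step_weight P a s" for s
    using R_pos lam_gt_1 prob_choicesD(1)[OF P]
    by (auto simp: step_weight_def less_imp_le split: prod.split intro!: divide_nonneg_nonneg mult_nonneg_nonneg)
  have "(\<Sum>s\<in>steps. step_weight P a s)
      = (\<Sum>c\<in>UNIV. \<Sum>u\<in>\<theta> c. \<Sum>j<length u. R $ c * P c u / (lam * R $ a) * (if u ! j = a then 1 else 0))"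
    unfolding sum_steps by (intro sum.cong refl) (auto simp: step_weight_def steps_def)
  also have "\<dots> = (\<Sum>c\<in>UNIV. \<Sum>u\<in>\<theta> c. P c u * (R $ c * (A *v abelianisation [c]) $ a / (lam * R $ a)))"
    unfolding sum_distrib_left[symmetric] sum_letter
    by (intro sum.cong refl) (simp add: abelianisation_image)
  also have "\<dots> = (\<Sum>c\<in>UNIV. R $ c * (A *v abelianisation [c]) $ a / (lam * R $ a))"
    unfolding sum_distrib_right[symmetric] by (simp add: prob_choicesD[OF P])
  also have "\<dots> = (A *v R) $ a / (lam * R $ a)"
  proof -
    have "(A *v abelianisation [c]) $ a = A $ a $ c" for c
      by (simp add: matrix_vector_mult_def abelianisation_def if_distrib[where f=real]
          if_distrib[where f="\<lambda>x. _ * x"] cong: if_cong)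
    then show ?thesis
      by (simp add: matrix_vector_mult_def mult.commute flip: sum_divide_distrib)
  qed
  also have "\<dots> = 1" using R_pos[of a] lam_gt_1 by (simp add: R_eigen)
  finally have sum1: "(\<Sum>s\<in>steps. step_weight P a s) = 1" .
  have "(\<integral>\<^sup>+ s. ennreal (step_weight P a s) \<partial>count_space UNIV) = (\<Sum>s\<in>steps. ennreal (step_weight P a s))"
    by (intro nn_integral_count_space') (auto simp: step_weight_def)
  also have "\<dots> = 1" using nonneg sum1 by simp
  finally show ?thesis unfolding step_pmf_def using pmf_embed_pmf[of "step_weight P a", OF nonneg] by blast
qed

text \<open>
  Bayes' formula: choosing a letter by frequency and then its ancestor amounts to choosing the ancestor
  by frequency, then its image, and then a position in the image.
\<close>

lemma sum_expectation_step_pmf: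
  assumes P: "P \<in> prob_choices \<theta>"
  shows "(\<Sum>a\<in>UNIV. R $ a * measure_pmf.expectation (step_pmf P a) (F a))
    = (\<Sum>c\<in>UNIV. R $ c * (\<Sum>u\<in>\<theta> c. P c u * (\<Sum>j<length u. F (u ! j) (c, u, j)))) / lam"
proof -
  have "measure_pmf.expectation (step_pmf P a) (F a) = (\<Sum>s\<in>steps. step_weight P a s * F a s)" for a
    by (subst integral_measure_pmf[of steps])
      (auto simp: pmf_step_pmf[OF P] set_pmf_eq step_weight_def split: if_splits)
  then have "(\<Sum>a\<in>UNIV. R $ a * measure_pmf.expectation (step_pmf P a) (F a))
      = (\<Sum>a\<in>UNIV. \<Sum>s\<in>steps. R $ a * (step_weight P a s * F a s))"
    by (simp add: sum_distrib_left)
  also have "\<dots> = (\<Sum>s\<in>steps. \<Sum>a\<in>UNIV. R $ a * (step_weight P a s * F a s))"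
    by (rule sum.swap)
  also have "\<dots> = (\<Sum>c\<in>UNIV. \<Sum>u\<in>\<theta> c. \<Sum>j<length u. R $ c * P c u * F (u ! j) (c, u, j) / lam)"
    unfolding sum_steps
  proof (intro sum.cong refl)
    fix c u j assume *: "u \<in> \<theta> c" "j \<in> {..<length u}"
    have "(\<Sum>a\<in>UNIV. R $ a * (step_weight P a (c, u, j) * F a (c, u, j)))
        = (\<Sum>a\<in>UNIV. if a = u ! j then R $ c * P c u * F (u ! j) (c, u, j) / lam else 0)"
      using * R_pos[of "u ! j"] by (intro sum.cong) (auto simp: step_weight_def steps_def)
    then show "(\<Sum>a\<in>UNIV. R $ a * (step_weight P a (c, u, j) * F a (c, u, j)))
        = R $ c * P c u * F (u ! j) (c, u, j) / lam" by simp
  qed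
  finally show ?thesis by (simp add: sum_distrib_left sum_divide_distrib mult.assoc)
qed

text \<open>
  The chain is driven by independent random maps: each element of the stream prepares a step for every
  letter, and only the step of the current letter is taken. In this way a product measure suffices to
  construct the chain, and it is the same for all starting letters.
\<close>

definition step_choice :: "('a \<Rightarrow> 'a list \<Rightarrow> real) \<Rightarrow> ('a \<Rightarrow> 'a \<times> 'a list \<times> nat) pmf" where
  "step_choice P = Pi_pmf UNIV undefined (step_pmf P)"

lemma map_step_choice: "map_pmf (\<lambda>f. f a) (step_choice P) = step_pmf P a"
  by (simp add: step_choice_def Pi_pmf_component)

abbreviation choices :: "('a \<Rightarrow> 'a list \<Rightarrow> real) \<Rightarrow> ('a \<Rightarrow> 'a \<times> 'a list \<times> nat) stream measure" where
  "choices P \<equiv> stream_space (measure_pmf (step_choice P))"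

lemma prob_space_choices: "prob_space (choices P)"
  by (rule prob_space.prob_space_stream_space[OF measure_pmf.prob_space_axioms])

primrec ancestor :: "nat \<Rightarrow> 'a \<Rightarrow> ('a \<Rightarrow> 'a \<times> 'a list \<times> nat) stream \<Rightarrow> 'a" where
  "ancestor 0 a \<omega> = a"
| "ancestor (Suc k) a \<omega> = ancestor k (fst (shd \<omega> a)) (stl \<omega>)"

text \<open>
  The value \<open>0\<close> outside \<open>steps\<close> keeps the displacements bounded on all streams, not only almost surely.
\<close>

definition displacement :: "'a \<times> 'a list \<times> nat \<Rightarrow> real ^ 'a" where
  "displacement = (\<lambda>(c, u, j). if (c, u, j) \<in> steps then pos (take j u) else 0)"

definition address :: "'a \<Rightarrow> ('a \<Rightarrow> 'a \<times> 'a list \<times> nat) stream \<Rightarrow> real ^ 'a" where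
  "address a \<omega> = (\<Sum>k. Apow k (displacement ((\<omega> !! k) (ancestor k a \<omega>))))"

lemma displacement_in_H: "displacement s \<in> H"
  by (cases s) (simp add: displacement_def pos_in_H subspace_0[OF subspace_H])

lemma nrm_displacement_le: "nrm (displacement s) \<le> (1 - rho) * radius"
  using nrm_displacement rho(2) radius_nonneg
  by (cases s) (auto simp: displacement_def steps_def nrm_0)

lemma nrm_address_term: "nrm (Apow k (displacement s)) \<le> rho ^ k * ((1 - rho) * radius)"
  using nrm_Apow[OF displacement_in_H, of k s] nrm_displacement_le[of s] rho(1)
  by (meson mult_left_mono order_trans zero_le_power)

lemma summable_address: "summable (\<lambda>k. Apow k (displacement (f k)))"
proof (rule summable_comparison_test')
  show "summable (\<lambda>k. rho ^ k * ((1 - rho) * radius))"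
    using rho by (intro summable_mult2 summable_geometric) auto
  fix k :: nat
  show "norm (Apow k (displacement (f k))) \<le> rho ^ k * ((1 - rho) * radius)"
    using norm_le_nrm[OF Apow_in_H[OF displacement_in_H]] nrm_address_term by (rule order_trans)
qed

lemma address_in_region: "address a \<omega> \<in> region radius"
proof -
  define f where "f k = Apow k (displacement ((\<omega> !! k) (ancestor k a \<omega>)))" for k
  have fH: "f k \<in> H" for k unfolding f_def by (intro Apow_in_H displacement_in_H)
  have sH: "sum f {..<n} \<in> H" for n using fH by (intro subspace_sum[OF subspace_H])
  have lim: "(\<lambda>n. sum f {..<n}) \<longlonglongrightarrow> address a \<omega>"
    unfolding address_def f_def by (intro summable_LIMSEQ summable_address)
  have aH: "address a \<omega> \<in> H"
    using closed_sequentially[OF closed_H _ lim] sH by blast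
  have nrm_sum: "nrm (sum f {..<n}) \<le> radius" for n
  proof -
    have "nrm (sum f {..<n}) \<le> (\<Sum>k<n. nrm (f k))"
      using fH by (intro norm_on_sum[OF subspace_H norm_on_nrm])
    also have "\<dots> \<le> (\<Sum>k<n. rho ^ k * ((1 - rho) * radius))"
      unfolding f_def by (intro sum_mono nrm_address_term)
    also have "\<dots> = (1 - rho ^ n) * radius"
      using rho(2) by (simp add: sum_gp_strict flip: sum_distrib_right)
    also have "\<dots> \<le> radius" using radius_nonneg rho by (simp add: algebra_simps)
    finally show ?thesis .
  qed
  obtain C where C: "C > 0" "\<And>x. x \<in> H \<Longrightarrow> nrm x \<le> C * norm x" using nrm_le_norm by blast
  \<comment> \<open>The bound passes to the limit because the adapted norm is dominated by the Euclidean one.\<close>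
  have "nrm (address a \<omega>) \<le> radius + C * norm (address a \<omega> - sum f {..<n})" for n
  proof -
    have dH: "address a \<omega> - sum f {..<n} \<in> H" using aH sH by (intro subspace_diff[OF subspace_H])
    have "nrm (address a \<omega>) \<le> nrm (sum f {..<n}) + nrm (address a \<omega> - sum f {..<n})"
      using nrm_triangle[OF sH[of n] dH] by simp
    with nrm_sum[of n] C(2)[OF dH] show ?thesis by linarith
  qed
  moreover have "(\<lambda>n. radius + C * norm (address a \<omega> - sum f {..<n})) \<longlonglongrightarrow> radius + C * norm (address a \<omega> - address a \<omega>)"
    by (intro tendsto_intros lim)
  ultimately have "nrm (address a \<omega>) \<le> radius + C * norm (address a \<omega> - address a \<omega>)"
    by (intro LIMSEQ_le_const) auto
  with aH show ?thesis by (simp add: region_def)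
qed

lemma address_in_H: "address a \<omega> \<in> H"
  using address_in_region by (auto simp: region_def)

text \<open>Self-similarity: the first step splits off, and the rest is seen from the ancestor.\<close>

lemma address_Stream: "address a (s ## \<omega>) = displacement (s a) + A *v address (fst (s a)) \<omega>"
proof -
  let ?f = "\<lambda>k. displacement (((s ## \<omega>) !! k) (ancestor k a (s ## \<omega>)))"
  let ?g = "\<lambda>k. displacement ((\<omega> !! k) (ancestor k (fst (s a)) \<omega>))"
  have "address a (s ## \<omega>) = (\<Sum>k. Apow (Suc k) (?f (Suc k))) + ?f 0"
    unfolding address_def using suminf_split_head[OF summable_address[of "\<lambda>k. ((s ## \<omega>) !! k) (ancestor k a (s ## \<omega>))"]]
    by simp
  also have "(\<Sum>k. Apow (Suc k) (?f (Suc k))) = (\<Sum>k. A *v Apow k (?g k))" by simp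
  also have "\<dots> = A *v (\<Sum>k. Apow k (?g k))"
    by (rule bounded_linear.suminf[OF matrix_vector_mul_bounded_linear summable_address, symmetric])
  finally show ?thesis by (simp add: address_def add.commute)
qed

lemma measurable_address: "address a \<in> choices P \<rightarrow>\<^sub>M hyperplane_borel L"
proof (rule measurable_restrict_space2)
  show "address a \<in> space (choices P) \<rightarrow> H" using address_in_H by blast
  have anc: "ancestor k a \<in> choices P \<rightarrow>\<^sub>M count_space UNIV" for k
  proof (induction k arbitrary: a)
    case (Suc k)
    have "(\<lambda>\<omega>. fst (shd \<omega> a)) \<in> choices P \<rightarrow>\<^sub>M count_space UNIV"
      by (rule measurable_compose[OF measurable_shd]) simp
    moreover have "(\<lambda>\<omega>. ancestor k i (stl \<omega>)) \<in> choices P \<rightarrow>\<^sub>M count_space UNIV" for i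
      by (rule measurable_compose[OF measurable_stl Suc])
    ultimately have "(\<lambda>\<omega>. ancestor k (fst (shd \<omega> a)) (stl \<omega>)) \<in> choices P \<rightarrow>\<^sub>M count_space UNIV"
      by (rule measurable_compose_countable[rotated])
    then show ?case by simp
  next
    case 0
    have "ancestor 0 a = (\<lambda>_. a)" by (rule ext) simp
    then show ?case by simp
  qed
  have "(\<lambda>\<omega>. Apow k (displacement ((\<omega> !! k) (ancestor k a \<omega>)))) \<in> borel_measurable (choices P)" for k
  proof (rule measurable_compose_countable[OF _ anc])
    fix i
    show "(\<lambda>\<omega>. Apow k (displacement ((\<omega> !! k) i))) \<in> borel_measurable (choices P)"
      by (rule measurable_compose[OF measurable_snth]) simp
  qed
  then show "address a \<in> borel_measurable (choices P)"
    unfolding address_def[abs_def] by (rule borel_measurable_suminf)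
qed

lemma compact_region_hull: "compact (cball 0 B \<inter> H)"
  using closed_H by (intro compact_Int_closed) auto

lemma region_subset: "region B \<subseteq> cball 0 B \<inter> H"
  using norm_le_nrm by (force simp: region_def)

lemma bounded_on_region:
  fixes g :: "real ^ 'a \<Rightarrow> real"
  assumes "continuous_on H g"
  shows "\<exists>C. \<forall>x\<in>region B. \<bar>g x\<bar> \<le> C"
proof -
  have "compact (g ` (cball 0 B \<inter> H))"
    using assms compact_region_hull by (intro compact_continuous_image) (auto elim: continuous_on_subset)
  then have "bounded (g ` (cball 0 B \<inter> H))" by (rule compact_imp_bounded)
  then obtain C where "\<forall>y\<in>g ` (cball 0 B \<inter> H). norm y \<le> C"
    unfolding bounded_iff by (elim exE)
  then show ?thesis using region_subset[of B] by (intro exI[of _ C]) auto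
qed

lemma measurable_address_fun:
  fixes g :: "real ^ 'a \<Rightarrow> real"
  assumes "continuous_on H g"
  shows "(\<lambda>\<omega>. g (address a \<omega>)) \<in> borel_measurable (choices P)"
  using measurable_address borel_measurable_continuous_on_restrict[OF assms] by (rule measurable_compose)

lemma integrable_address:
  fixes g :: "real ^ 'a \<Rightarrow> real"
  assumes "continuous_on H g"
  shows "integrable (choices P) (\<lambda>\<omega>. g (address a \<omega>))"
proof -
  interpret prob_space "choices P" by (rule prob_space_choices)
  obtain C where "\<And>x. x \<in> region radius \<Longrightarrow> \<bar>g x\<bar> \<le> C" using bounded_on_region[OF assms] by blast
  then show ?thesis
    using address_in_region measurable_address_fun[OF assms] by (intro integrable_const_bound[of _ C]) auto
qed

lemma continuous_on_affine_comp:
  fixes g :: "real ^ 'a \<Rightarrow> real"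
  assumes "continuous_on H g" "t \<in> H"
  shows "continuous_on H (\<lambda>x. g (t + A *v x))"
proof (rule continuous_on_compose2[OF assms(1)])
  show "continuous_on H (\<lambda>x. t + A *v x)"
    by (intro continuous_intros linear_continuous_on_compose[OF continuous_on_id] matrix_vector_mul_linear)
  show "(\<lambda>x. t + A *v x) ` H \<subseteq> H"
    using assms(2) A_in_H subspace_add[OF subspace_H] by blast
qed

definition mean :: "('a \<Rightarrow> 'a list \<Rightarrow> real) \<Rightarrow> ('a \<Rightarrow> real ^ 'a \<Rightarrow> real) \<Rightarrow> real" where
  "mean P G = (\<Sum>a\<in>UNIV. R $ a * (\<integral>\<omega>. G a (address a \<omega>) \<partial>choices P))"

text \<open>
  The self-similarity of the addresses, averaged over one step of the chain and combined with Bayes'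
  formula for this step.
\<close>

lemma mean_transfer:
  assumes P: "P \<in> prob_choices \<theta>" and G: "\<And>a. continuous_on H (G a)"
  shows "mean P (transfer P G) = lam * mean P G"
proof -
  define \<phi> where "\<phi> a s = (\<integral>\<omega>. G a (displacement s + A *v address (fst s) \<omega>) \<partial>choices P)" for a s
  note cont = continuous_on_affine_comp[OF G displacement_in_H]
  have "(\<integral>\<omega>. G a (address a \<omega>) \<partial>choices P) = measure_pmf.expectation (step_pmf P a) (\<phi> a)" for a
  proof -
    obtain C where C: "\<And>x. x \<in> region radius \<Longrightarrow> \<bar>G a x\<bar> \<le> C" using bounded_on_region[OF G] by blast
    have "(\<integral>\<omega>. G a (address a \<omega>) \<partial>choices P)
        = (\<integral>s. \<integral>\<omega>. G a (address a (s ## \<omega>)) \<partial>choices P \<partial>step_choice P)"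
      using C address_in_region
      by (intro prob_space.integral_stream_space[OF measure_pmf.prob_space_axioms, of _ _ C] measurable_address_fun G) auto
    also have "\<dots> = measure_pmf.expectation (step_choice P) (\<lambda>s. \<phi> a (s a))"
      unfolding address_Stream \<phi>_def ..
    also have "\<dots> = measure_pmf.expectation (map_pmf (\<lambda>s. s a) (step_choice P)) (\<phi> a)" by simp
    finally show ?thesis by (simp only: map_step_choice)
  qed
  then have "lam * mean P G
      = (\<Sum>c\<in>UNIV. R $ c * (\<Sum>u\<in>\<theta> c. P c u * (\<Sum>j<length u. \<phi> (u ! j) (c, u, j))))"
    using lam_gt_1 by (simp add: mean_def sum_expectation_step_pmf[OF P])
  also have "\<dots> = (\<Sum>c\<in>UNIV. R $ c * (\<integral>\<omega>. transfer P G c (address c \<omega>) \<partial>choices P))"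
  proof (intro sum.cong refl arg_cong2[where f = "(*)"])
    fix c
    have int: "integrable (choices P) (\<lambda>\<omega>. G i (A *v address c \<omega> + pos w))" for i w
      using integrable_address[OF continuous_on_affine_comp[OF G pos_in_H]] by (simp add: add.commute)
    have "(\<integral>\<omega>. transfer P G c (address c \<omega>) \<partial>choices P)
        = (\<Sum>u\<in>\<theta> c. P c u * (\<Sum>j<length u. \<integral>\<omega>. G (u ! j) (A *v address c \<omega> + pos (take j u)) \<partial>choices P))"
      unfolding transfer_def path_sum_eq
      by (simp add: Bochner_Integration.integral_sum Bochner_Integration.integrable_sum int)
    also have "\<dots> = (\<Sum>u\<in>\<theta> c. P c u * (\<Sum>j<length u. \<phi> (u ! j) (c, u, j)))"
      by (intro sum.cong arg_cong2[where f = "(*)"] refl)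
        (simp add: \<phi>_def displacement_def steps_def add.commute)
    finally show "(\<Sum>u\<in>\<theta> c. P c u * (\<Sum>j<length u. \<phi> (u ! j) (c, u, j)))
        = (\<integral>\<omega>. transfer P G c (address c \<omega>) \<partial>choices P)" ..
  qed
  finally show ?thesis by (simp add: mean_def)
qed

lemma mean_transfer_pow:
  assumes P: "P \<in> prob_choices \<theta>" and G: "\<And>a. continuous_on H (G a)"
  shows "mean P ((transfer P ^^ n) G) = lam ^ n * mean P G"
  by (induction n) (simp_all add: mean_transfer[OF P continuous_on_transfer_pow[OF G]])

end

section \<open>Finite measures and bounded continuous functions\<close>

text \<open>
  Continuous functions of the distance to a closed set decrease to its indicator, and the closed sets
  form an intersection-stable generator.
\<close>

lemma finite_measure_eqI_continuous:
  fixes M N :: "'b::euclidean_space measure"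
  assumes fin: "finite_measure M" "finite_measure N"
    and S: "sets M = sets (restrict_space borel S)" "sets N = sets (restrict_space borel S)"
    and eq: "\<And>g::'b \<Rightarrow> real. continuous_on S g \<Longrightarrow> bounded (g ` S) \<Longrightarrow> (\<integral>x. g x \<partial>M) = (\<integral>x. g x \<partial>N)"
  shows "M = N"
proof -
  have spM: "space M = S" and spN: "space N = S"
    using S[THEN sets_eq_imp_space_eq] by (simp_all add: space_restrict_space)
  have id_M: "(\<lambda>x. x) \<in> M \<rightarrow>\<^sub>M borel" and id_N: "(\<lambda>x. x) \<in> N \<rightarrow>\<^sub>M borel"
    using S by (auto simp: measurable_cong_sets[of M "restrict_space borel S" borel borel]
        measurable_cong_sets[of N "restrict_space borel S" borel borel] intro: measurable_restrict_space1)
  have lim: "(\<lambda>k. \<integral>x. max 0 (1 - real k * infdist x C) \<partial>M) \<longlonglongrightarrow> measure M (C \<inter> space M)"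
    if C: "closed C" "C \<noteq> {}" and M: "finite_measure M" "(\<lambda>x. x) \<in> M \<rightarrow>\<^sub>M borel"
    for C :: "'b set" and M
  proof -
    interpret finite_measure M by fact
    note M(2)[measurable]
    have Cm: "C \<inter> space M \<in> sets M"
      using measurable_sets[OF M(2), of C] C(1) by (simp add: Int_commute vimage_def)
    have "(\<lambda>k. \<integral>x. max 0 (1 - real k * infdist x C) \<partial>M) \<longlonglongrightarrow> (\<integral>x. indicator C x \<partial>M)"
    proof (rule integral_dominated_convergence[where w = "\<lambda>_. 1"])
      show "(\<lambda>x. indicator C x) \<in> borel_measurable M"
        using C(1) by (intro measurable_compose[OF M(2)] borel_measurable_indicator) simp
      show "(\<lambda>x. max 0 (1 - real k * infdist x C)) \<in> borel_measurable M" for k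
        by (intro measurable_compose[OF M(2)] borel_measurable_continuous_onI continuous_intros)
      show "AE x in M. (\<lambda>k. max 0 (1 - real k * infdist x C)) \<longlonglongrightarrow> indicator C x"
      proof (rule AE_I2)
        fix x
        show "(\<lambda>k. max 0 (1 - real k * infdist x C)) \<longlonglongrightarrow> indicator C x"
        proof (cases "x \<in> C")
          case False
          then have pos: "infdist x C > 0"
            using C by (metis in_closed_iff_infdist_zero infdist_nonneg less_eq_real_def)
          obtain K where K: "1 / infdist x C < real K" using reals_Archimedean2 by blast
          have "\<forall>\<^sub>F k in sequentially. max 0 (1 - real k * infdist x C) = 0"
          proof (rule eventually_sequentiallyI[of K])
            fix k assume "K \<le> k"
            then have "1 / infdist x C \<le> real k" using K by linarith
            then show "max 0 (1 - real k * infdist x C) = 0" using pos by (simp add: field_simps)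
          qed
          then show ?thesis using False by (simp add: tendsto_eventually)
        qed simp
      qed
      show "AE x in M. norm (max 0 (1 - real k * infdist x C)) \<le> 1" for k
        by (rule AE_I2) (simp add: infdist_nonneg)
    qed simp
    also have "(\<integral>x. indicator C x \<partial>M) = (\<integral>x. indicator (C \<inter> space M) x \<partial>M)"
      by (intro Bochner_Integration.integral_cong) (auto simp: indicator_def)
    also have "\<dots> = measure M (C \<inter> space M)" using Cm by simp
    finally show ?thesis .
  qed
  have closed_eq: "measure M (C \<inter> S) = measure N (C \<inter> S)" if C: "closed C" for C
  proof (cases "C = {}")
    case False
    have "(\<integral>x. max 0 (1 - real k * infdist x C) \<partial>M) = (\<integral>x. max 0 (1 - real k * infdist x C) \<partial>N)" for k
    proof (rule eq)
      show "continuous_on S (\<lambda>x. max 0 (1 - real k * infdist x C))" by (intro continuous_intros)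
      show "bounded ((\<lambda>x. max 0 (1 - real k * infdist x C)) ` S)"
        unfolding bounded_iff by (intro exI[of _ 1]) (auto simp: infdist_nonneg)
    qed
    then show ?thesis
      using lim[OF C False fin(1) id_M] lim[OF C False fin(2) id_N] LIMSEQ_unique
      unfolding spM spN by auto
  qed simp
  interpret M: finite_measure M by (rule fin)
  interpret N: finite_measure N by (rule fin)
  have "distr M borel (\<lambda>x. x) = distr N borel (\<lambda>x. x)"
  proof (rule measure_eqI_generator_eq[of "{C. closed C}" UNIV _ _ "\<lambda>_. UNIV"])
    fix C :: "'b set" assume "C \<in> {C. closed C}"
    then show "emeasure (distr M borel (\<lambda>x. x)) C = emeasure (distr N borel (\<lambda>x. x)) C"
      using closed_eq[of C]
      by (simp add: emeasure_distr id_M id_N spM spN M.emeasure_eq_measure N.emeasure_eq_measure)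
  next
    show "emeasure (distr M borel (\<lambda>x. x)) UNIV \<noteq> \<infinity>" by (simp add: emeasure_distr id_M)
  qed (auto simp: Int_stable_def borel_eq_closed)
  note eq_distr = this
  show "M = N"
  proof (rule measure_eqI)
    fix B assume "B \<in> sets M"
    then obtain B' where B': "B' \<in> sets borel" "B = S \<inter> B'"
      unfolding S by (auto simp: sets_restrict_space)
    then show "emeasure M B = emeasure N B"
      using arg_cong[OF eq_distr, of "\<lambda>M. emeasure M B'"]
      by (simp add: emeasure_distr id_M id_N spM spN Int_commute)
  qed (simp add: S)
qed

lemma integral_scale_measure:
  fixes f :: "'b \<Rightarrow> real"
  assumes "0 \<le> c" "f \<in> borel_measurable M"
  shows "(\<integral>x. f x \<partial>scale_measure (ennreal c) M) = c * (\<integral>x. f x \<partial>M)"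
proof -
  have "scale_measure (ennreal c) M = density M (\<lambda>_. ennreal c)"
    by (rule measure_eqI) (simp_all add: emeasure_density_const)
  with assms show ?thesis by (simp add: integral_density)
qed

context rauzy_setting
begin

section \<open>Asymptotics of the transfer operator\<close>

text \<open>
  Uniform continuity on a compact set containing the region, combined with the contraction by \<open>A\<^sup>n\<close>. The
  bound does not involve probabilities, which makes the next lemma uniform in \<open>P\<close>.
\<close>

lemma eventually_small_oscillation:
  assumes G: "\<And>a. continuous_on H (G a)" and e: "0 < e"
  shows "\<forall>\<^sub>F n in sequentially. \<forall>x\<in>region B. \<forall>y\<in>region B. \<forall>a. \<forall>x'\<in>region B. \<forall>y'\<in>region B.
    x' - y' = Apow n (x - y) \<longrightarrow> \<bar>G a x' - G a y'\<bar> \<le> e * L $ a"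
proof -
  have "\<exists>d>0. \<forall>x\<in>region B. \<forall>y\<in>region B. dist x y < d \<longrightarrow> \<bar>G a x - G a y\<bar> \<le> e * L $ a" for a
  proof -
    have "uniformly_continuous_on (cball 0 B \<inter> H) (G a)"
      using compact_region_hull G by (intro compact_uniformly_continuous) (auto intro: continuous_on_subset[OF G])
    then obtain d where d: "d > 0"
      "\<And>x y. x \<in> cball 0 B \<inter> H \<Longrightarrow> y \<in> cball 0 B \<inter> H \<Longrightarrow> dist y x < d \<Longrightarrow> dist (G a y) (G a x) < e * L $ a"
      using L_pos[of a] e unfolding uniformly_continuous_on_def by (metis mult_pos_pos)
    show ?thesis
    proof (intro exI[of _ d] conjI ballI impI d(1))
      fix x y assume "x \<in> region B" "y \<in> region B" "dist x y < d"
      then show "\<bar>G a x - G a y\<bar> \<le> e * L $ a"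
        using d(2)[of y x] region_subset by (force simp: dist_real_def)
    qed
  qed
  then obtain d where d: "\<And>a. d a > 0"
    "\<And>a x y. x \<in> region B \<Longrightarrow> y \<in> region B \<Longrightarrow> dist x y < d a \<Longrightarrow> \<bar>G a x - G a y\<bar> \<le> e * L $ a"
    by metis
  have "(\<lambda>n. rho ^ n * (B + B)) \<longlonglongrightarrow> 0 * (B + B)"
    using rho by (intro tendsto_intros LIMSEQ_power_zero) auto
  then have "\<forall>\<^sub>F n in sequentially. rho ^ n * (B + B) < d a" for a
    using d(1)[of a] by (auto dest: order_tendstoD(2))
  then have "\<forall>\<^sub>F n in sequentially. \<forall>a. rho ^ n * (B + B) < d a"
    by (rule eventually_all_finite)
  then show ?thesis
  proof (eventually_elim, intro ballI allI impI)
    fix n x y a x' y'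
    assume n: "\<forall>a. rho ^ n * (B + B) < d a"
      and xy: "x \<in> region B" "y \<in> region B" "x' \<in> region B" "y' \<in> region B" "x' - y' = Apow n (x - y)"
    have xyH: "x \<in> H" "y \<in> H" "- y \<in> H" "x - y \<in> H"
      using xy subspace_H by (auto simp: region_def subspace_diff subspace_neg)
    have "nrm (- y) = nrm y" using nrm_scale[OF xyH(2), of "-1"] by simp
    then have "nrm (x - y) \<le> B + B"
      using nrm_triangle[OF xyH(1,3)] xy by (simp add: region_def)
    have "dist x' y' = norm (Apow n (x - y))" using xy(5) by (simp add: dist_norm)
    also have "\<dots> \<le> nrm (Apow n (x - y))" by (intro norm_le_nrm Apow_in_H xyH)
    also have "\<dots> \<le> rho ^ n * nrm (x - y)" by (intro nrm_Apow xyH)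
    also have "\<dots> \<le> rho ^ n * (B + B)" using \<open>nrm (x - y) \<le> B + B\<close> rho by (intro mult_left_mono) auto
    also have "\<dots> < d a" using n by blast
    finally show "\<bar>G a x' - G a y'\<bar> \<le> e * L $ a" using d(2) xy by blast
  qed
qed

lemma eventually_transfer_pow_nearly_const:
  assumes G: "\<And>a. continuous_on H (G a)" and e: "0 < e" and B: "radius \<le> B"
  shows "\<forall>\<^sub>F n in sequentially. \<forall>P\<in>prob_choices \<theta>. \<forall>c. \<forall>x\<in>region B. \<forall>y\<in>region B.
    \<bar>(transfer P ^^ n) G c x - (transfer P ^^ n) G c y\<bar> \<le> e * lam ^ n * L $ c"
  using eventually_small_oscillation[OF G e, of B]
proof (rule eventually_mono)
  fix n
  assume osc: "\<forall>x\<in>region B. \<forall>y\<in>region B. \<forall>a. \<forall>x'\<in>region B. \<forall>y'\<in>region B.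
    x' - y' = Apow n (x - y) \<longrightarrow> \<bar>G a x' - G a y'\<bar> \<le> e * L $ a"
  show "\<forall>P\<in>prob_choices \<theta>. \<forall>c. \<forall>x\<in>region B. \<forall>y\<in>region B.
    \<bar>(transfer P ^^ n) G c x - (transfer P ^^ n) G c y\<bar> \<le> e * lam ^ n * L $ c"
  proof (intro ballI allI)
    fix P c x y assume "P \<in> prob_choices \<theta>" and xy: "x \<in> region B" "y \<in> region B"
    then show "\<bar>(transfer P ^^ n) G c x - (transfer P ^^ n) G c y\<bar> \<le> e * lam ^ n * L $ c"
      using osc B by (intro transfer_pow_diff_le[where B = B]) blast+
  qed
qed

lemma sum_R_L: "(\<Sum>a\<in>UNIV. R $ a * L $ a) = 1"
  using L_R by (simp add: inner_vec_def mult.commute)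

text \<open>The normalisation \<open>L \<bullet> R = 1\<close> turns \<open>L\<close>-weighted bounds into bounds for the mean.\<close>

lemma mean_diff_le:
  assumes F: "\<And>a. continuous_on H (F a)" and G: "\<And>a. continuous_on H (G a)"
    and le: "\<And>a x. x \<in> region radius \<Longrightarrow> \<bar>F a x - G a x\<bar> \<le> e * L $ a"
  shows "\<bar>mean P F - mean P G\<bar> \<le> e"
proof -
  interpret prob_space "choices P" by (rule prob_space_choices)
  let ?I = "\<lambda>F a. \<integral>\<omega>. F a (address a \<omega>) \<partial>choices P"
  have *: "\<bar>?I F a - ?I G a\<bar> \<le> e * L $ a" for a
  proof -
    have "?I F a - ?I G a = (\<integral>\<omega>. F a (address a \<omega>) - G a (address a \<omega>) \<partial>choices P)"
      using integrable_address[OF F] integrable_address[OF G] by simp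
    also have "\<bar>\<dots>\<bar> \<le> (\<integral>\<omega>. \<bar>F a (address a \<omega>) - G a (address a \<omega>)\<bar> \<partial>choices P)"
      by (rule integral_abs_bound)
    also have "\<dots> \<le> (\<integral>\<omega>. e * L $ a \<partial>choices P)"
      using le address_in_region integrable_address[OF F] integrable_address[OF G]
      by (intro integral_mono integrable_abs Bochner_Integration.integrable_diff integrable_const) auto
    finally show ?thesis by (simp add: prob_space)
  qed
  have "mean P F - mean P G = (\<Sum>a\<in>UNIV. R $ a * (?I F a - ?I G a))"
    by (simp add: mean_def right_diff_distrib sum_subtractf)
  also have "\<bar>\<dots>\<bar> \<le> (\<Sum>a\<in>UNIV. R $ a * (e * L $ a))"
    using * R_pos by (intro order_trans[OF sum_abs] sum_mono) (simp add: abs_mult less_imp_le)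
  also have "\<dots> = e * (\<Sum>a\<in>UNIV. R $ a * L $ a)" by (simp add: sum_distrib_left mult_ac)
  finally show ?thesis by (simp add: sum_R_L)
qed

lemma mean_const: "mean P (\<lambda>a _. v $ a) = v \<bullet> R"
proof -
  interpret prob_space "choices P" by (rule prob_space_choices)
  show ?thesis by (simp add: mean_def prob_space inner_vec_def mult.commute)
qed

lemma mean_diff_const_le:
  assumes F: "\<And>a. continuous_on H (F a)"
    and le: "\<And>a x. x \<in> region radius \<Longrightarrow> \<bar>F a x - v $ a\<bar> \<le> e * L $ a"
  shows "\<bar>mean P F - v \<bullet> R\<bar> \<le> e"
  using mean_diff_le[of F "\<lambda>a _. v $ a", OF F continuous_on_const le] by (simp add: mean_const)

text \<open>
  First choose \<open>n\<close> such that \<open>F = T\<^sup>n G\<close> is within \<open>e \<lambda>\<^sup>n\<close> of a family of constants \<open>v\<close>. Applying \<open>T\<^sup>m\<close>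
  preserves the relative error, and on \<open>v\<close> the operator obeys the Perron--Frobenius limit with value
  \<open>v \<bullet> R\<close>. The same \<open>v\<close> approximates the mean, because the mean of \<open>F\<close> is \<open>\<lambda>\<^sup>n\<close> times the mean of \<open>G\<close>.
\<close>

lemma transfer_pow_tendsto:
  assumes P: "P \<in> prob_choices \<theta>" and G: "\<And>a. continuous_on H (G a)"
    and B: "radius \<le> B" and x: "x \<in> region B"
  shows "(\<lambda>n. (transfer P ^^ n) G c x / lam ^ n) \<longlonglongrightarrow> L $ c * mean P G"
proof (rule LIMSEQ_I)
  fix r :: real assume r: "0 < r"
  \<comment> \<open>Three errors of size \<open>e * L $ c\<close> will occur; the factor \<open>4\<close> makes their sum less than \<open>r\<close>.\<close>
  define e where "e = r / (4 * L $ c)"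
  have e: "0 < e" using r L_pos[of c] by (simp add: e_def)
  have lam_pow: "0 < lam ^ k" for k using lam_gt_1 by simp
  obtain n where n: "\<And>c x y. x \<in> region B \<Longrightarrow> y \<in> region B \<Longrightarrow>
      \<bar>(transfer P ^^ n) G c x - (transfer P ^^ n) G c y\<bar> \<le> e * lam ^ n * L $ c"
    using eventually_transfer_pow_nearly_const[of G, OF G e B] P unfolding eventually_sequentially by blast
  define F where "F = (transfer P ^^ n) G"
  define v where "v = (\<chi> a. F a 0)"
  have zero: "0 \<in> region B" using radius_nonneg B by (intro zero_in_region) simp
  have near: "\<bar>F a y - v $ a\<bar> \<le> e * lam ^ n * L $ a" if "y \<in> region B" for a y
    using n[OF that zero] by (simp add: F_def v_def)
  have "region radius \<subseteq> region B" using B by (auto simp: region_def)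
  then have "\<bar>mean P F - v \<bullet> R\<bar> \<le> e * lam ^ n"
    using near G by (intro mean_diff_const_le) (auto simp: F_def continuous_on_transfer_pow)
  then have "\<bar>lam ^ n * (mean P G - (v \<bullet> R) / lam ^ n)\<bar> \<le> lam ^ n * e"
    using lam_gt_1 by (simp add: F_def mean_transfer_pow[OF P G] right_diff_distrib mult.commute)
  then have mean: "\<bar>mean P G - (v \<bullet> R) / lam ^ n\<bar> \<le> e"
    using lam_pow[of n] by (simp add: abs_mult)
  have "(\<lambda>m. v \<bullet> (Apow m (abelianisation [c]) /\<^sub>R lam ^ m)) \<longlonglongrightarrow> v \<bullet> ((L \<bullet> abelianisation [c]) *\<^sub>R R)"
    by (intro tendsto_inner tendsto_const Apow_scaled_tendsto)
  then have "(\<lambda>m. v \<bullet> Apow m (abelianisation [c]) / lam ^ m) \<longlonglongrightarrow> L $ c * (v \<bullet> R)"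
    by (simp add: inner_abelianisation_single divide_inverse mult.commute)
  then have lim: "(\<lambda>m. v \<bullet> Apow m (abelianisation [c]) / lam ^ m / lam ^ n) \<longlonglongrightarrow> L $ c * (v \<bullet> R) / lam ^ n"
    using lam_gt_1 by (intro tendsto_divide tendsto_const) auto
  have "0 < e * L $ c" using e L_pos[of c] by simp
  then obtain m0 where m0: "\<And>m. m \<ge> m0 \<Longrightarrow>
      \<bar>v \<bullet> Apow m (abelianisation [c]) / lam ^ m / lam ^ n - L $ c * (v \<bullet> R) / lam ^ n\<bar> < e * L $ c"
    using LIMSEQ_D[OF lim] unfolding real_norm_def by blast
  show "\<exists>no. \<forall>k\<ge>no. norm ((transfer P ^^ k) G c x / lam ^ k - L $ c * mean P G) < r"
  proof (intro exI[of _ "m0 + n"] allI impI)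
    fix k assume k: "m0 + n \<le> k"
    define m where "m = k - n"
    have m: "k = m + n" "m0 \<le> m" using k by (auto simp: m_def)
    have "\<bar>(transfer P ^^ m) F c x - (transfer P ^^ m) (\<lambda>a _. v $ a) c x\<bar> \<le> (e * lam ^ n) * lam ^ m * L $ c"
      using x near by (intro transfer_pow_diff_le[OF P B]) auto
    then have "\<bar>(transfer P ^^ k) G c x - v \<bullet> Apow m (abelianisation [c])\<bar> \<le> lam ^ k * (e * L $ c)"
      unfolding transfer_pow_const[OF P] by (simp add: F_def m(1) funpow_add power_add mult_ac)
    then have "\<bar>(transfer P ^^ k) G c x - v \<bullet> Apow m (abelianisation [c])\<bar> / lam ^ k \<le> e * L $ c"
      using lam_pow[of k] by (simp add: pos_divide_le_eq mult.commute)
    then have 1: "\<bar>(transfer P ^^ k) G c x / lam ^ k - v \<bullet> Apow m (abelianisation [c]) / lam ^ m / lam ^ n\<bar> \<le> e * L $ c"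
      using lam_pow[of k] by (simp add: m(1) power_add mult.commute abs_divide flip: diff_divide_distrib)
    have "L $ c * \<bar>mean P G - (v \<bullet> R) / lam ^ n\<bar> \<le> L $ c * e"
      using mean L_pos[of c] by (intro mult_left_mono) auto
    then have 2: "\<bar>L $ c * mean P G - L $ c * (v \<bullet> R) / lam ^ n\<bar> \<le> e * L $ c"
      using L_pos[of c] by (simp add: abs_mult mult.commute flip: right_diff_distrib times_divide_eq_right)
    have "4 * (e * L $ c) = r" using L_pos[of c] by (simp add: e_def)
    with 1 2 m0[OF m(2)] r show "norm ((transfer P ^^ k) G c x / lam ^ k - L $ c * mean P G) < r"
      unfolding real_norm_def by linarith
  qed
qed

lemma path_sum_transfer_tendsto:
  assumes P: "P \<in> prob_choices \<theta>" and G: "\<And>a. continuous_on H (G a)"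
  shows "(\<lambda>n. path_sum ((transfer P ^^ n) G) 0 v / lam ^ n) \<longlonglongrightarrow> (L \<bullet> abelianisation v) * mean P G"
proof -
  define B where "B = radius + (\<Sum>j<length v. nrm (pos (take j v)))"
  have nn: "0 \<le> nrm (pos w)" for w by (intro nrm_nonneg pos_in_H)
  have B: "radius \<le> B" using nn by (simp add: B_def sum_nonneg)
  have "pos (take j v) \<in> region B" if "j < length v" for j
    using member_le_sum[of j "{..<length v}" "\<lambda>j. nrm (pos (take j v))"] nn radius_nonneg that
    by (simp add: region_def pos_in_H B_def)
  then have "(\<lambda>n. \<Sum>j<length v. (transfer P ^^ n) G (v ! j) (pos (take j v)) / lam ^ n)
      \<longlonglongrightarrow> (\<Sum>j<length v. L $ (v ! j) * mean P G)"
    by (intro tendsto_sum transfer_pow_tendsto[OF P G B]) auto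
  then show ?thesis
    by (simp add: path_sum_eq L_abelianisation sum_distrib_right sum_divide_distrib)
qed

section \<open>The Rauzy measures\<close>

text \<open>Tests the measure of the letter \<open>a\<close> alone.\<close>

abbreviation at_letter :: "'a \<Rightarrow> (real ^ 'a \<Rightarrow> real) \<Rightarrow> 'a \<Rightarrow> real ^ 'a \<Rightarrow> real" where
  "at_letter a g \<equiv> (\<lambda>b x. if b = a then g x else 0)"

lemma continuous_on_at_letter: "continuous_on H g \<Longrightarrow> continuous_on H (at_letter a g b)"
  by (cases "b = a") auto

lemma mean_at_letter: "mean P (at_letter a g) = R $ a * (\<integral>\<omega>. g (address a \<omega>) \<partial>choices P)"
proof -
  have "mean P (at_letter a g)
      = (\<Sum>b\<in>UNIV. if b = a then R $ a * (\<integral>\<omega>. g (address a \<omega>) \<partial>choices P) else 0)"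
    unfolding mean_def by (intro sum.cong) auto
  then show ?thesis by simp
qed

lemma length_eq_sum_abelianisation: "real (length w) = (\<Sum>i\<in>UNIV. abelianisation w $ i)" for w :: "'a list"
proof (induction w)
  case (Cons i w)
  then show ?case using abelianisation_append[of "[i]" w]
    by (simp add: sum.distrib abelianisation_def if_distrib[where f=real] cong: if_cong)
qed (simp add: abelianisation_Nil)

text \<open>
  As a path sum of the constant \<open>1\<close>, the length falls under the same asymptotics as the measures.
\<close>

lemma iterate_length_eq:
  assumes P: "P \<in> prob_choices \<theta>"
  shows "real (iterate_length P n v) = path_sum ((transfer P ^^ n) (\<lambda>_ _. 1)) 0 v"
proof -
  let ?p = "random_iterate P n v"
  obtain w0 where w0: "w0 \<in> set_pmf ?p" using set_pmf_not_empty[of ?p] by blast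
  have len: "length w = length w0" if "w \<in> set_pmf ?p" for w
    using abelianisation_random_iterate[OF P that] abelianisation_random_iterate[OF P w0]
      length_eq_sum_abelianisation[of w] length_eq_sum_abelianisation[of w0] by simp
  have "iterate_length P n v = length w0"
    unfolding iterate_length_def
  proof (rule the_equality)
    show "\<forall>w\<in>set_pmf ?p. length w = length w0" using len by blast
    show "l = length w0" if "\<forall>w\<in>set_pmf ?p. length w = l" for l using that w0 by auto
  qed
  moreover have "path_sum (\<lambda>_ _. 1) 0 = (\<lambda>w. real (length w))"
    by (rule ext) (simp add: path_sum_eq)
  moreover have "measure_pmf.expectation ?p (\<lambda>w. real (length w)) = measure_pmf.expectation ?p (\<lambda>_. real (length w0))"
    by (intro integral_cong_AE) (auto simp: AE_measure_pmf_iff dest: len)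
  ultimately show ?thesis
    using expectation_random_iterate[OF P, of n v "\<lambda>_ _. 1"] by simp
qed

text \<open>
  The expectation of the word measures as the image of a weighted counting measure on the pairs of a
  realisation and a position of \<open>a\<close> in it, which makes integrals finite sums.
\<close>

lemma expected_word_measure_eq:
  fixes p :: "'a list pmf" and a :: 'a
  assumes fin: "finite (set_pmf p)"
  defines "T \<equiv> SIGMA w:set_pmf p. {m. m < length w \<and> w ! m = a}"
  shows "expected_word_measure L R a p
    = distr (density (count_space T) (\<lambda>(w, m). ennreal (pmf p w))) (hyperplane_borel L) (\<lambda>(w, m). pos (take m w))"
    (is "_ = ?N")
proof -
  have finT: "finite T" unfolding T_def using fin by (intro finite_SigmaI) auto
  have meas: "(\<lambda>m. pos (take m w)) \<in> count_space X \<rightarrow>\<^sub>M hyperplane_borel L" for X w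
    using pos_in_H by (simp add: space_restrict_space)
  have measT: "(\<lambda>(w, m). pos (take m w)) \<in> density (count_space T) (\<lambda>(w, m). ennreal (pmf p w)) \<rightarrow>\<^sub>M hyperplane_borel L"
    using pos_in_H by (auto simp: space_restrict_space measurable_def)
  have eq: "(\<integral>\<^sup>+ w. emeasure (word_measure L R a w) B \<partial>measure_pmf p) = emeasure ?N B"
    if B: "B \<in> sets (hyperplane_borel L)" for B
  proof -
    have wm: "emeasure (word_measure L R a w) B
        = (\<Sum>m | m < length w \<and> w ! m = a. indicator B (pos (take m w)))" for w
    proof -
      have "emeasure (word_measure L R a w) B = (\<integral>\<^sup>+ x. indicator B x \<partial>word_measure L R a w)"
        using B by (simp add: word_measure_def)
      also have "\<dots> = (\<integral>\<^sup>+ m. indicator B (pos (take m w)) \<partial>count_space {m. m < length w \<and> w ! m = a})"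
        unfolding word_measure_def pos_def[symmetric] using B by (intro nn_integral_distr meas) simp
      finally show ?thesis by (simp add: nn_integral_count_space_finite)
    qed
    have "(\<integral>\<^sup>+ w. emeasure (word_measure L R a w) B \<partial>measure_pmf p)
        = (\<Sum>w\<in>set_pmf p. \<Sum>m | m < length w \<and> w ! m = a. indicator B (pos (take m w)) * ennreal (pmf p w))"
      unfolding wm by (simp add: nn_integral_measure_pmf_finite fin sum_distrib_right)
    also have "\<dots> = (\<Sum>(w, m)\<in>T. indicator B (pos (take m w)) * ennreal (pmf p w))"
      unfolding T_def using fin by (subst sum.Sigma) auto
    also have "\<dots> = (\<integral>\<^sup>+ x. ennreal (pmf p (fst x)) * indicator B (pos (take (snd x) (fst x))) \<partial>count_space T)"
      by (simp add: nn_integral_count_space_finite finT split_beta mult.commute)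
    also have "\<dots> = (\<integral>\<^sup>+ x. indicator B (pos (take (snd x) (fst x))) \<partial>density (count_space T) (\<lambda>(w, m). ennreal (pmf p w)))"
      by (subst nn_integral_density) (simp_all add: split_beta)
    also have "\<dots> = (\<integral>\<^sup>+ x. indicator B x \<partial>?N)"
      using B by (subst nn_integral_distr[OF measT]) (simp_all add: split_beta)
    also have "\<dots> = emeasure ?N B" using B by simp
    finally show ?thesis .
  qed
  have "expected_word_measure L R a p = measure_of (space ?N) (sets ?N) (emeasure ?N)"
    unfolding expected_word_measure_def space_distr sets_distr
  proof (subst space_restrict_space, simp, rule measure_of_eq)
    show "sets (hyperplane_borel L) \<subseteq> Pow H"
      using sets.space_closed[of "hyperplane_borel L"] by (simp add: space_restrict_space)
    fix B assume "B \<in> sigma_sets H (sets (hyperplane_borel L))"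
    then have "B \<in> sets (hyperplane_borel L)"
      using sets.sigma_sets_eq[of "hyperplane_borel L"] by (simp add: space_restrict_space)
    then show "(\<integral>\<^sup>+ w. emeasure (word_measure L R a w) B \<partial>measure_pmf p) = emeasure ?N B" by (rule eq)
  qed
  then show ?thesis by (simp only: measure_of_of_measure)
qed

lemma integral_expected_word_measure:
  assumes fin: "finite (set_pmf p)" and g: "continuous_on H g" and c: "0 \<le> c"
  shows "(\<integral>x. g x \<partial>scale_measure (ennreal c) (expected_word_measure L R a p))
    = c * measure_pmf.expectation p (path_sum (at_letter a g) 0)"
proof -
  define T where "T = (SIGMA w:set_pmf p. {m. m < length w \<and> w ! m = a})"
  have finT: "finite T" unfolding T_def using fin by (intro finite_SigmaI) auto
  let ?N = "density (count_space T) (\<lambda>(w, m). ennreal (pmf p w))"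
  have gm: "g \<in> borel_measurable (hyperplane_borel L)"
    using g by (rule borel_measurable_continuous_on_restrict)
  have meas: "(\<lambda>(w, m). pos (take m w)) \<in> ?N \<rightarrow>\<^sub>M hyperplane_borel L"
    using pos_in_H by (auto simp: space_restrict_space measurable_def)
  have "(\<integral>x. g x \<partial>scale_measure (ennreal c) (expected_word_measure L R a p))
      = c * (\<integral>x. g (case x of (w, m) \<Rightarrow> pos (take m w)) \<partial>?N)"
    unfolding expected_word_measure_eq[OF fin] T_def[symmetric] using gm c
    by (simp add: integral_scale_measure integral_distr[OF meas gm])
  also have "(\<integral>x. g (case x of (w, m) \<Rightarrow> pos (take m w)) \<partial>?N)
      = (\<integral>x. pmf p (fst x) * g (pos (take (snd x) (fst x))) \<partial>count_space T)"
  proof -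
    have "?N = density (count_space T) (\<lambda>x. ennreal (pmf p (fst x)))" by (simp add: case_prod_unfold)
    then show ?thesis by (simp add: integral_density split_beta)
  qed
  also have "\<dots> = (\<Sum>x\<in>T. pmf p (fst x) * g (pos (take (snd x) (fst x))))"
    by (simp add: lebesgue_integral_count_space_finite finT)
  also have "\<dots> = (\<Sum>w\<in>set_pmf p. \<Sum>m | m < length w \<and> w ! m = a. pmf p w * g (pos (take m w)))"
    unfolding T_def using fin by (subst sum.Sigma) (auto simp: split_beta)
  also have "\<dots> = (\<Sum>w\<in>set_pmf p. pmf p w * path_sum (at_letter a g) 0 w)"
  proof (intro sum.cong refl)
    fix w
    have "(\<Sum>m | m < length w \<and> w ! m = a. g (pos (take m w))) = path_sum (at_letter a g) 0 w"
      unfolding path_sum_eq by (subst sum.inter_filter[symmetric]) (auto intro!: sum.cong)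
    then show "(\<Sum>m | m < length w \<and> w ! m = a. pmf p w * g (pos (take m w))) = pmf p w * path_sum (at_letter a g) 0 w"
      by (simp flip: sum_distrib_left)
  qed
  also have "\<dots> = measure_pmf.expectation p (path_sum (at_letter a g) 0)"
    using fin by (subst integral_measure_pmf[of "set_pmf p"]) auto
  finally show ?thesis .
qed

definition address_law :: "('a \<Rightarrow> 'a list \<Rightarrow> real) \<Rightarrow> 'a \<Rightarrow> (real ^ 'a) measure" where
  "address_law P a = distr (choices P) (hyperplane_borel L) (address a)"

lemma prob_space_address_law: "prob_space (address_law P a)"
  unfolding address_law_def by (rule prob_space.prob_space_distr[OF prob_space_choices measurable_address])

lemma sets_address_law: "sets (address_law P a) = sets (hyperplane_borel L)"
  by (simp add: address_law_def)

lemma space_address_law: "space (address_law P a) = H"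
  by (simp add: address_law_def space_restrict_space)

lemma integral_address_law:
  fixes g :: "real ^ 'a \<Rightarrow> real"
  assumes "continuous_on H g"
  shows "(\<integral>x. g x \<partial>address_law P a) = (\<integral>\<omega>. g (address a \<omega>) \<partial>choices P)"
  unfolding address_law_def
  by (rule integral_distr[OF measurable_address borel_measurable_continuous_on_restrict[OF assms]])

text \<open>
  The averages for the measure of \<open>a\<close> and for the length grow like \<open>\<lambda>\<^sup>n\<close> with the same dependence
  \<open>L \<bullet> abelianisation v\<close> on the initial word, which therefore cancels. Uniqueness of the limit is
  needed because the Rauzy measure is defined by a description.
\<close>

lemma rauzy_measure_eq:
  assumes P: "P \<in> prob_choices \<theta>"
  shows "rauzy_measure L R P a = scale_measure (ennreal (R $ a)) (address_law P a)"
    (is "_ = ?\<mu>")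
proof -
  let ?\<mu>n = "\<lambda>v n. scale_measure (ennreal (1 / real (iterate_length P n v)))
      (expected_word_measure L R a (random_iterate P n v))"
  interpret A: prob_space "address_law P a" by (rule prob_space_address_law)
  have int_mu: "(\<integral>x. g x \<partial>?\<mu>) = mean P (at_letter a g)" if "continuous_on H g" for g
    using that borel_measurable_continuous_on_restrict[OF that] R_pos[of a]
    by (subst integral_scale_measure)
      (auto simp: mean_at_letter integral_address_law less_imp_le measurable_cong_sets[OF sets_address_law refl])
  have lim: "(\<lambda>n. \<integral>x. g x \<partial>?\<mu>n v n) \<longlonglongrightarrow> mean P (at_letter a g)"
    if g: "continuous_on H g" and v: "v \<noteq> []" for g v
  proof -
    have "L \<bullet> abelianisation v > 0"
      unfolding L_abelianisation using v L_pos by (intro sum_pos) auto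
    have one: "mean P (\<lambda>_ _. 1) = 1"
    proof -
      interpret prob_space "choices P" by (rule prob_space_choices)
      show ?thesis by (simp add: mean_def sum_R prob_space)
    qed
    have "(\<lambda>n. path_sum ((transfer P ^^ n) (at_letter a g)) 0 v / lam ^ n
          / (path_sum ((transfer P ^^ n) (\<lambda>_ _. 1)) 0 v / lam ^ n))
        \<longlonglongrightarrow> (L \<bullet> abelianisation v) * mean P (at_letter a g) / ((L \<bullet> abelianisation v) * mean P (\<lambda>_ _. 1))"
      using \<open>L \<bullet> abelianisation v > 0\<close> one
      by (intro tendsto_divide path_sum_transfer_tendsto[OF P] continuous_on_at_letter g continuous_on_const) auto
    moreover have "path_sum ((transfer P ^^ n) (at_letter a g)) 0 v / lam ^ n
        / (path_sum ((transfer P ^^ n) (\<lambda>_ _. 1)) 0 v / lam ^ n) = (\<integral>x. g x \<partial>?\<mu>n v n)" for n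
    proof -
      have "(\<integral>x. g x \<partial>?\<mu>n v n) = 1 / real (iterate_length P n v) * path_sum ((transfer P ^^ n) (at_letter a g)) 0 v"
        by (subst integral_expected_word_measure[OF finite_set_pmf_random_iterate[OF P] g])
          (simp_all add: expectation_random_iterate[OF P])
      then show ?thesis using lam_gt_1 by (simp add: iterate_length_eq[OF P])
    qed
    ultimately show ?thesis using \<open>L \<bullet> abelianisation v > 0\<close> one by simp
  qed
  have space: "space M = H" if "sets M = sets (hyperplane_borel L)" for M
    using sets_eq_imp_space_eq[OF that] by (simp add: space_restrict_space)
  have mu: "finite_measure ?\<mu>" "sets ?\<mu> = sets (hyperplane_borel L)"
    by (auto intro!: finite_measureI simp: ennreal_mult_eq_top_iff sets_address_law A.emeasure_finite
        space_scale_measure)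
  show ?thesis
    unfolding rauzy_measure_def
  proof (rule the_equality)
    show "finite_measure ?\<mu> \<and> sets ?\<mu> = sets (hyperplane_borel L) \<and>
        (\<forall>v. v \<noteq> [] \<longrightarrow> weakly_tendsto (?\<mu>n v) ?\<mu> sequentially)"
      using mu lim space[OF mu(2)] int_mu by (auto simp: weakly_tendsto_def)
  next
    fix \<nu> assume \<nu>: "finite_measure \<nu> \<and> sets \<nu> = sets (hyperplane_borel L) \<and>
        (\<forall>v. v \<noteq> [] \<longrightarrow> weakly_tendsto (?\<mu>n v) \<nu> sequentially)"
    then have sp: "space \<nu> = H" using space by blast
    have "(\<integral>x. g x \<partial>\<nu>) = (\<integral>x. g x \<partial>?\<mu>)" if g: "continuous_on H g" "bounded (g ` H)" for g :: "real ^ 'a \<Rightarrow> real"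
    proof -
      have "(\<lambda>n. \<integral>x. g x \<partial>?\<mu>n [a] n) \<longlonglongrightarrow> (\<integral>x. g x \<partial>\<nu>)"
        using \<nu> g unfolding weakly_tendsto_def sp by blast
      from LIMSEQ_unique[OF this lim[OF g(1), of "[a]"]] show ?thesis
        using int_mu[OF g(1)] by simp
    qed
    then show "\<nu> = ?\<mu>"
      using \<nu> mu by (intro finite_measure_eqI_continuous[of \<nu> ?\<mu> H]) auto
  qed
qed

lemma normalised_rauzy_measure_eq:
  assumes P: "P \<in> prob_choices \<theta>"
  shows "normalised_rauzy_measure L R P a = address_law P a"
  using R_pos[of a]
  by (simp add: normalised_rauzy_measure_def rauzy_measure_eq[OF P] flip: ennreal_mult)

end

context rauzy_setting
begin

section \<open>Dependence on the probabilities\<close>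

definition prob_dist :: "('a \<Rightarrow> 'a list \<Rightarrow> real) \<Rightarrow> ('a \<Rightarrow> 'a list \<Rightarrow> real) \<Rightarrow> real" where
  "prob_dist P Q = (\<Sum>c\<in>UNIV. \<Sum>u\<in>\<theta> c. \<bar>P c u - Q c u\<bar>)"

text \<open>
  The weights \<open>L $ a\<close> are those for which the transfer operator scales the constant \<open>k\<close> by \<open>\<rho> \<lambda>\<close>.
\<close>

definition lipschitz_family :: "real \<Rightarrow> ('a \<Rightarrow> real ^ 'a \<Rightarrow> real) \<Rightarrow> bool" where
  "lipschitz_family k G \<longleftrightarrow> (\<forall>a. \<forall>x\<in>H. \<forall>y\<in>H. \<bar>G a x - G a y\<bar> \<le> k * nrm (x - y) * L $ a)"

lemma continuous_on_of_nrm_bound: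
  fixes g :: "real ^ 'a \<Rightarrow> real"
  assumes k: "0 \<le> k" and g: "\<And>x y. x \<in> H \<Longrightarrow> y \<in> H \<Longrightarrow> \<bar>g x - g y\<bar> \<le> k * nrm (x - y)"
  shows "continuous_on H g"
proof -
  obtain C where C: "C > 0" "\<And>x. x \<in> H \<Longrightarrow> nrm x \<le> C * norm x" using nrm_le_norm by blast
  have "(k * C)-lipschitz_on H g"
  proof (rule lipschitz_onI)
    fix x y assume xy: "x \<in> H" "y \<in> H"
    have "\<bar>g x - g y\<bar> \<le> k * nrm (x - y)" by (rule g[OF xy])
    also have "\<dots> \<le> k * (C * norm (x - y))"
      using xy k subspace_diff[OF subspace_H] by (intro mult_left_mono C) auto
    finally show "dist (g x) (g y) \<le> k * C * dist x y" by (simp add: dist_norm)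
  qed (use k C in simp)
  then show ?thesis by (rule lipschitz_on_continuous_on)
qed

lemma lipschitz_family_continuous:
  assumes "lipschitz_family k G" "0 \<le> k"
  shows "continuous_on H (G a)"
proof (rule continuous_on_of_nrm_bound)
  show "0 \<le> k * L $ a" using assms(2) L_pos[of a] by simp
  show "\<bar>G a x - G a y\<bar> \<le> k * L $ a * nrm (x - y)" if "x \<in> H" "y \<in> H" for x y
    using assms(1) that by (simp add: lipschitz_family_def mult_ac)
qed

lemma lipschitz_family_transfer:
  assumes P: "P \<in> prob_choices \<theta>" and G: "lipschitz_family k G" and k: "0 \<le> k"
  shows "lipschitz_family (k * rho * lam) (transfer P G)"
  unfolding lipschitz_family_def
proof (intro allI ballI)
  fix c x y assume xy: "x \<in> H" "y \<in> H"
  have "\<bar>transfer P G c x - transfer P G c y\<bar> \<le> (k * (rho * nrm (x - y))) * lam * L $ c"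
  proof (rule transfer_diff_le[OF P])
    fix u j
    let ?t = "pos (take j u)"
    have "\<bar>G (u ! j) (A *v x + ?t) - G (u ! j) (A *v y + ?t)\<bar>
        \<le> k * nrm ((A *v x + ?t) - (A *v y + ?t)) * L $ (u ! j)"
      using G xy unfolding lipschitz_family_def
      by (blast intro: subspace_add[OF subspace_H] A_in_H pos_in_H)
    also have "(A *v x + ?t) - (A *v y + ?t) = A *v (x - y)" by (simp add: vec.diff)
    also have "k * nrm (A *v (x - y)) * L $ (u ! j) \<le> k * (rho * nrm (x - y)) * L $ (u ! j)"
      using xy k L_pos subspace_diff[OF subspace_H]
      by (intro mult_right_mono mult_left_mono rho(3)) (auto simp: less_imp_le)
    finally show "\<bar>G (u ! j) (A *v x + ?t) - G (u ! j) (A *v y + ?t)\<bar> \<le> k * (rho * nrm (x - y)) * L $ (u ! j)" .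
  qed
  then show "\<bar>transfer P G c x - transfer P G c y\<bar> \<le> k * rho * lam * nrm (x - y) * L $ c"
    by (simp add: mult_ac)
qed

lemma lipschitz_family_near_origin:
  assumes G: "lipschitz_family k G" and k: "0 \<le> k" and x: "x \<in> region radius"
  shows "\<bar>G a x - G a 0\<bar> \<le> k * radius * L $ a"
proof -
  have "\<bar>G a x - G a 0\<bar> \<le> k * nrm (x - 0) * L $ a"
    using G x subspace_0[OF subspace_H] unfolding lipschitz_family_def region_def by blast
  also have "\<dots> \<le> k * radius * L $ a"
    using x k L_pos[of a] by (intro mult_right_mono mult_left_mono) (auto simp: region_def)
  finally show ?thesis .
qed

text \<open>
  Path sums over the different images of \<open>c\<close> agree up to \<open>k * radius * \<lambda> * L $ c\<close> with the same number,
  the path sum of the constants \<open>G a 0\<close>; this number drops out since \<open>P\<close> and \<open>Q\<close> have equal total mass. So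
  the bound depends on the Lipschitz constant only and not on the size of \<open>G\<close>.
\<close>

lemma transfer_prob_diff_le:
  assumes P: "P \<in> prob_choices \<theta>" and Q: "Q \<in> prob_choices \<theta>"
    and G: "lipschitz_family k G" and k: "0 \<le> k" and x: "x \<in> region radius"
  shows "\<bar>transfer P G c x - transfer Q G c x\<bar> \<le> k * radius * lam * prob_dist P Q * L $ c"
proof -
  define v where "v = (\<chi> a. G a 0)"
  have v: "v \<bullet> abelianisation [a] = G a 0" for a
    by (simp add: v_def inner_abelianisation_single)
  have near: "\<bar>path_sum G (A *v x) u - v \<bullet> abelianisation u\<bar> \<le> k * radius * (lam * L $ c)"
    if u: "u \<in> \<theta> c" for u
  proof -
    have "\<bar>path_sum G (A *v x) u - path_sum (\<lambda>a _. G a 0) (A *v x) u\<bar> \<le> k * radius * (L \<bullet> abelianisation u)"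
      using u x by (intro path_sum_diff_le lipschitz_family_near_origin[OF G k] region_step) auto
    then show ?thesis
      using path_sum_const[of v 0 "A *v x" u] by (simp add: v L_abelianisation_image[OF u])
  qed
  have const: "v \<bullet> abelianisation u = v \<bullet> (A *v abelianisation [c])" if "u \<in> \<theta> c" for u
    using that by (simp add: abelianisation_image)
  have "(\<Sum>u\<in>\<theta> c. (P c u - Q c u) * (v \<bullet> abelianisation u))
      = (\<Sum>u\<in>\<theta> c. (P c u - Q c u)) * (v \<bullet> (A *v abelianisation [c]))"
    unfolding sum_distrib_right by (intro sum.cong) (auto simp: const)
  also have "\<dots> = 0" by (simp add: sum_subtractf prob_choicesD[OF P] prob_choicesD[OF Q])
  finally have zero: "(\<Sum>u\<in>\<theta> c. (P c u - Q c u) * (v \<bullet> abelianisation u)) = 0" .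
  have "transfer P G c x - transfer Q G c x
      = (\<Sum>u\<in>\<theta> c. (P c u - Q c u) * path_sum G (A *v x) u)"
    by (simp add: transfer_def left_diff_distrib sum_subtractf)
  also have "\<dots> = (\<Sum>u\<in>\<theta> c. (P c u - Q c u) * (path_sum G (A *v x) u - v \<bullet> abelianisation u))"
    using zero by (simp add: right_diff_distrib sum_subtractf)
  also have "\<bar>\<dots>\<bar> \<le> (\<Sum>u\<in>\<theta> c. \<bar>P c u - Q c u\<bar> * (k * radius * (lam * L $ c)))"
    using near by (intro order_trans[OF sum_abs] sum_mono) (simp add: abs_mult mult_left_mono)
  also have "\<dots> = (\<Sum>u\<in>\<theta> c. \<bar>P c u - Q c u\<bar>) * (k * radius * (lam * L $ c))"
    by (simp add: sum_distrib_right)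
  also have "\<dots> \<le> prob_dist P Q * (k * radius * (lam * L $ c))"
    unfolding prob_dist_def using k radius_nonneg lam_gt_1 L_pos[of c]
    by (intro mult_right_mono member_le_sum[of c UNIV "\<lambda>c. \<Sum>u\<in>\<theta> c. \<bar>P c u - Q c u\<bar>"])
      (auto intro: sum_nonneg)
  finally show ?thesis by (simp add: mult_ac)
qed

text \<open>
  The contraction argument. The summand with \<open>rho ^ n\<close> is the trivial bound after \<open>n\<close> steps, and
  \<open>radius * prob_dist P Q / (1 - rho)\<close> is the fixed point of the recursion \<open>s \<mapsto> rho * s + radius * prob_dist P Q\<close>.
\<close>

lemma mean_lipschitz_aux:
  assumes P: "P \<in> prob_choices \<theta>" and Q: "Q \<in> prob_choices \<theta>"
    and "lipschitz_family k G" "0 \<le> k"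
  shows "\<bar>mean P G - mean Q G\<bar> \<le> k * (rho ^ n * (2 * radius) + radius * prob_dist P Q / (1 - rho))"
  using assms(3,4)
proof (induction n arbitrary: k G)
  case 0
  note cont = lipschitz_family_continuous[OF 0]
  define v where "v = (\<chi> a. G a 0)"
  have "\<bar>mean P' G - v \<bullet> R\<bar> \<le> k * radius" for P'
    using lipschitz_family_near_origin[OF 0] by (intro mean_diff_const_le cont) (simp add: v_def)
  from this[of P] this[of Q] have "\<bar>mean P G - mean Q G\<bar> \<le> k * (2 * radius)" by linarith
  also have "\<dots> \<le> k * (rho ^ 0 * (2 * radius) + radius * prob_dist P Q / (1 - rho))"
    using 0 radius_nonneg rho
    by (intro mult_left_mono) (auto simp: prob_dist_def intro!: divide_nonneg_nonneg mult_nonneg_nonneg sum_nonneg)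
  finally show ?case .
next
  case (Suc n)
  note cont = lipschitz_family_continuous[OF Suc.prems]
  let ?b = "radius * prob_dist P Q"
  have k': "0 \<le> k * rho * lam" using Suc.prems rho lam_gt_1 by simp
  have 1: "\<bar>mean P (transfer P G) - mean Q (transfer P G)\<bar>
      \<le> k * rho * lam * (rho ^ n * (2 * radius) + ?b / (1 - rho))"
    using lipschitz_family_transfer[OF P Suc.prems] k' by (rule Suc.IH)
  have 2: "\<bar>mean Q (transfer P G) - mean Q (transfer Q G)\<bar> \<le> k * radius * lam * prob_dist P Q"
    using transfer_prob_diff_le[OF P Q Suc.prems]
    by (intro mean_diff_le continuous_on_transfer cont) auto
  have "lam * \<bar>mean P G - mean Q G\<bar> = \<bar>mean P (transfer P G) - mean Q (transfer Q G)\<bar>"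
    using lam_gt_1 by (simp add: mean_transfer[OF P cont] mean_transfer[OF Q cont] abs_mult
        flip: right_diff_distrib)
  also have "\<dots> \<le> k * rho * lam * (rho ^ n * (2 * radius) + ?b / (1 - rho)) + k * radius * lam * prob_dist P Q"
    using 1 2 by linarith
  also have "\<dots> = lam * (k * (rho ^ Suc n * (2 * radius) + (rho * (?b / (1 - rho)) + ?b)))"
    by (simp add: algebra_simps)
  also have "rho * (?b / (1 - rho)) + ?b = ?b / (1 - rho)"
    using rho(2) by (simp add: field_simps)
  finally show ?case using lam_gt_1 by simp
qed

lemma mean_lipschitz:
  assumes P: "P \<in> prob_choices \<theta>" and Q: "Q \<in> prob_choices \<theta>"
    and "lipschitz_family k G" "0 \<le> k"
  shows "\<bar>mean P G - mean Q G\<bar> \<le> k * (radius * prob_dist P Q / (1 - rho))"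
proof -
  have "(\<lambda>n. k * (rho ^ n * (2 * radius) + radius * prob_dist P Q / (1 - rho)))
      \<longlonglongrightarrow> k * (0 * (2 * radius) + radius * prob_dist P Q / (1 - rho))"
    using rho by (intro tendsto_mult tendsto_add tendsto_const LIMSEQ_power_zero) auto
  then have "\<bar>mean P G - mean Q G\<bar> \<le> k * (0 * (2 * radius) + radius * prob_dist P Q / (1 - rho))"
    by (rule LIMSEQ_le_const) (use mean_lipschitz_aux[OF assms] in auto)
  then show ?thesis by simp
qed

text \<open>
  A function that is \<open>1\<close>-Lipschitz for \<open>\<eta>\<close> is Lipschitz for the adapted norm, as norms on the hyperplane
  are equivalent; placed at the letter \<open>a\<close> it forms a Lipschitz family.
\<close>

lemma mk_dist_le:
  assumes \<eta>: "norm_on H \<eta>"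
  shows "\<exists>K. \<forall>P\<in>prob_choices \<theta>. \<forall>Q\<in>prob_choices \<theta>.
    mk_dist (\<lambda>x y. \<eta> (x - y)) (address_law Q a) (address_law P a) \<le> ennreal (K * prob_dist Q P)"
proof -
  obtain C where C: "C > 0" "\<And>x. x \<in> H \<Longrightarrow> \<eta> x \<le> C * norm x"
    using norm_on_le_norm[OF subspace_H \<eta>] by blast
  define k where "k = C / L $ a"
  have k: "0 \<le> k" using C L_pos[of a] by (simp add: k_def)
  define K where "K = k * radius / ((1 - rho) * R $ a)"
  have bound: "\<bar>(\<integral>x. g x \<partial>address_law Q a) - (\<integral>x. g x \<partial>address_law P a)\<bar> \<le> K * prob_dist Q P"
    if P: "P \<in> prob_choices \<theta>" and Q: "Q \<in> prob_choices \<theta>"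
      and g: "\<And>x y. x \<in> H \<Longrightarrow> y \<in> H \<Longrightarrow> \<bar>g x - g y\<bar> \<le> \<eta> (x - y)" for P Q g
  proof -
    have g': "\<bar>g x - g y\<bar> \<le> C * nrm (x - y)" if xy: "x \<in> H" "y \<in> H" for x y
    proof -
      have d: "x - y \<in> H" using xy by (rule subspace_diff[OF subspace_H])
      have "\<bar>g x - g y\<bar> \<le> C * norm (x - y)" using g[OF xy] C(2)[OF d] by linarith
      also have "\<dots> \<le> C * nrm (x - y)" using C(1) norm_le_nrm[OF d] by simp
      finally show ?thesis .
    qed
    then have cont: "continuous_on H g" using C(1) by (intro continuous_on_of_nrm_bound[of C]) auto
    have "lipschitz_family k (at_letter a g)"
      unfolding lipschitz_family_def
    proof (intro allI ballI)
      fix b x y assume xy: "x \<in> H" "y \<in> H"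
      have "0 \<le> nrm (x - y)" using xy by (intro nrm_nonneg subspace_diff[OF subspace_H])
      then show "\<bar>at_letter a g b x - at_letter a g b y\<bar> \<le> k * nrm (x - y) * L $ b"
        using g'[OF xy] L_pos[of a] L_pos[of b] k by (auto simp: k_def)
    qed
    then have "\<bar>mean Q (at_letter a g) - mean P (at_letter a g)\<bar> \<le> k * (radius * prob_dist Q P / (1 - rho))"
      using mean_lipschitz[OF Q P _ k] by blast
    then have "R $ a * \<bar>(\<integral>x. g x \<partial>address_law Q a) - (\<integral>x. g x \<partial>address_law P a)\<bar>
        \<le> k * (radius * prob_dist Q P / (1 - rho))"
      using R_pos[of a]
      by (simp add: mean_at_letter integral_address_law[OF cont] abs_mult flip: right_diff_distrib)
    also have "\<dots> = R $ a * (K * prob_dist Q P)"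
      using R_pos[of a] by (simp add: K_def)
    finally show ?thesis using R_pos[of a] by simp
  qed
  have "mk_dist (\<lambda>x y. \<eta> (x - y)) (address_law Q a) (address_law P a) \<le> ennreal (K * prob_dist Q P)"
    if "P \<in> prob_choices \<theta>" "Q \<in> prob_choices \<theta>" for P Q
    unfolding mk_dist_def space_address_law
    by (rule SUP_least) (auto intro!: ennreal_leI bound[OF that])
  then show ?thesis by blast
qed

lemma prob_dist_tendsto_0: "((\<lambda>Q. prob_dist Q P) \<longlongrightarrow> 0) (at P within S)"
proof -
  have "((\<lambda>Q. Q c u) \<longlongrightarrow> P c u) (at P within S)" for c u
    by (rule tendsto_coordinates) (rule tendsto_ident_at)
  then have "((\<lambda>Q. prob_dist Q P) \<longlongrightarrow> (\<Sum>c\<in>UNIV. \<Sum>u\<in>\<theta> c. \<bar>P c u - P c u\<bar>)) (at P within S)"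
    unfolding prob_dist_def by (intro tendsto_intros)
  then show ?thesis by simp
qed

text \<open>
  At a fixed time \<open>n\<close> the mean is approximated with the same error for all probabilities, by a quantity
  that is continuous in them.
\<close>

lemma mean_tendsto:
  assumes P: "P \<in> prob_choices \<theta>" and G: "\<And>a. continuous_on H (G a)"
  shows "((\<lambda>Q. mean Q G) \<longlongrightarrow> mean P G) (at P within prob_choices \<theta>)"
proof (rule tendstoI)
  fix e :: real assume e: "0 < e"
  obtain n where n: "\<And>Q c x y. Q \<in> prob_choices \<theta> \<Longrightarrow> x \<in> region radius \<Longrightarrow> y \<in> region radius \<Longrightarrow>
      \<bar>(transfer Q ^^ n) G c x - (transfer Q ^^ n) G c y\<bar> \<le> e / 4 * lam ^ n * L $ c"
    using eventually_transfer_pow_nearly_const[of G "e / 4" radius, OF G] e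
    unfolding eventually_sequentially by force
  \<comment> \<open>The origin is an arbitrary point of the region at which \<open>transfer Q ^^ n\<close> is evaluated.\<close>
  define v where "v Q = (\<chi> a. (transfer Q ^^ n) G a 0)" for Q
  have lam_pow: "0 < lam ^ n" using lam_gt_1 by simp
  have near: "\<bar>mean Q G - (v Q \<bullet> R) / lam ^ n\<bar> \<le> e / 4" if Q: "Q \<in> prob_choices \<theta>" for Q
  proof -
    have "\<bar>mean Q ((transfer Q ^^ n) G) - v Q \<bullet> R\<bar> \<le> e / 4 * lam ^ n"
      using n[OF Q _ zero_in_region[OF radius_nonneg]]
      by (intro mean_diff_const_le continuous_on_transfer_pow G) (simp add: v_def)
    then have "\<bar>lam ^ n * (mean Q G - (v Q \<bullet> R) / lam ^ n)\<bar> \<le> lam ^ n * (e / 4)"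
      using lam_gt_1 by (simp add: mean_transfer_pow[OF Q G] right_diff_distrib mult.commute)
    then show ?thesis using lam_pow by (simp add: abs_mult)
  qed
  have "((\<lambda>Q. (v Q \<bullet> R) / lam ^ n) \<longlongrightarrow> (v P \<bullet> R) / lam ^ n) (at P within prob_choices \<theta>)"
    unfolding v_def inner_vec_def using lam_gt_1
    by (intro tendsto_intros) (auto intro!: transfer_pow_tendsto_prob tendsto_ident_at)
  then have "\<forall>\<^sub>F Q in at P within prob_choices \<theta>. dist ((v Q \<bullet> R) / lam ^ n) ((v P \<bullet> R) / lam ^ n) < e / 2"
    using e by (intro tendstoD) auto
  moreover have "\<forall>\<^sub>F Q in at P within prob_choices \<theta>. Q \<in> prob_choices \<theta>"
    by (simp add: eventually_at_filter)
  ultimately show "\<forall>\<^sub>F Q in at P within prob_choices \<theta>. dist (mean Q G) (mean P G) < e"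
  proof eventually_elim
    case (elim Q)
    then show ?case using near[OF P] near[OF elim(2)] unfolding dist_real_def by linarith
  qed
qed

lemma address_law_tendsto:
  fixes g :: "real ^ 'a \<Rightarrow> real"
  assumes P: "P \<in> prob_choices \<theta>" and g: "continuous_on H g"
  shows "((\<lambda>Q. \<integral>x. g x \<partial>address_law Q a) \<longlongrightarrow> (\<integral>x. g x \<partial>address_law P a)) (at P within prob_choices \<theta>)"
proof -
  have eq: "(\<integral>x. g x \<partial>address_law Q a) = mean Q (at_letter a g) / R $ a" for Q
    using R_pos[of a] by (simp add: mean_at_letter integral_address_law[OF g])
  show ?thesis
    unfolding eq using R_pos[of a]
    by (intro tendsto_divide tendsto_const mean_tendsto P continuous_on_at_letter g) auto
qed

theorem normalised_rauzy_measure_continuous: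
  assumes \<eta>: "norm_on H \<eta>" and P: "P \<in> prob_choices \<theta>"
  shows "prob_space (normalised_rauzy_measure L R P a)"
    and "((\<lambda>Q. mk_dist (\<lambda>x y. \<eta> (x - y))
        (normalised_rauzy_measure L R Q a) (normalised_rauzy_measure L R P a)) \<longlongrightarrow> 0)
      (at P within prob_choices \<theta>)"
    and "weakly_tendsto (\<lambda>Q. normalised_rauzy_measure L R Q a) (normalised_rauzy_measure L R P a)
      (at P within prob_choices \<theta>)"
proof -
  let ?F = "at P within prob_choices \<theta>"
  have ev: "\<forall>\<^sub>F Q in ?F. Q \<in> prob_choices \<theta>" by (simp add: eventually_at_filter)
  note eq = normalised_rauzy_measure_eq
  show "prob_space (normalised_rauzy_measure L R P a)"
    by (simp add: eq[OF P] prob_space_address_law)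
  obtain K where K: "\<And>Q. Q \<in> prob_choices \<theta> \<Longrightarrow>
      mk_dist (\<lambda>x y. \<eta> (x - y)) (address_law Q a) (address_law P a) \<le> ennreal (K * prob_dist Q P)"
    using mk_dist_le[OF \<eta>] P by blast
  have "((\<lambda>Q. ennreal (K * prob_dist Q P)) \<longlongrightarrow> ennreal (K * 0)) ?F"
    by (intro tendsto_ennrealI tendsto_mult tendsto_const prob_dist_tendsto_0)
  then have lim: "((\<lambda>Q. ennreal (K * prob_dist Q P)) \<longlongrightarrow> 0) ?F" by simp
  show "((\<lambda>Q. mk_dist (\<lambda>x y. \<eta> (x - y))
      (normalised_rauzy_measure L R Q a) (normalised_rauzy_measure L R P a)) \<longlongrightarrow> 0) ?F"
  proof (rule tendsto_sandwich[OF _ _ tendsto_const lim])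
    show "\<forall>\<^sub>F Q in ?F. mk_dist (\<lambda>x y. \<eta> (x - y)) (normalised_rauzy_measure L R Q a)
        (normalised_rauzy_measure L R P a) \<le> ennreal (K * prob_dist Q P)"
      using ev by eventually_elim (simp add: eq[OF P] eq K)
  qed simp
  show "weakly_tendsto (\<lambda>Q. normalised_rauzy_measure L R Q a) (normalised_rauzy_measure L R P a) ?F"
    unfolding weakly_tendsto_def eq[OF P] space_address_law
  proof (intro allI impI)
    fix g :: "real ^ 'a \<Rightarrow> real" assume "continuous_on H g"
    from address_law_tendsto[OF P this]
    show "((\<lambda>Q. \<integral>x. g x \<partial>normalised_rauzy_measure L R Q a) \<longlongrightarrow> (\<integral>x. g x \<partial>address_law P a)) ?F"
      by (rule Lim_transform_eventually) (use ev in eventually_elim, simp add: eq)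
  qed
qed

end

theorem corollary5p9:
  fixes \<theta> :: "'a::finite \<Rightarrow> 'a list set"
    and L R :: "real ^ 'a"
    and \<eta> :: "real ^ 'a \<Rightarrow> real"
  assumes "set_substitution \<theta>"
    and "irreducible_pisot \<theta>"
    and "left_pf_eigenvector (subst_matrix \<theta>) L"
    and "right_pf_eigenvector (subst_matrix \<theta>) R"
    and "(\<Sum>i\<in>UNIV. \<bar>R $ i\<bar>) = 1"
    and "L \<bullet> R = 1"
    and "norm_on (orth_hyperplane L) \<eta>"
  shows "\<forall>a. \<forall>P\<in>prob_choices \<theta>.
    prob_space (normalised_rauzy_measure L R P a) \<and>
    ((\<lambda>Q. mk_dist (\<lambda>x y. \<eta> (x - y))
        (normalised_rauzy_measure L R Q a) (normalised_rauzy_measure L R P a)) \<longlongrightarrow> 0)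
      (at P within prob_choices \<theta>) \<and>
    weakly_tendsto (\<lambda>Q. normalised_rauzy_measure L R Q a) (normalised_rauzy_measure L R P a)
      (at P within prob_choices \<theta>)"
proof -
  let ?M = "subst_matrix \<theta>"
  obtain l where l: "pf_eigenvalue ?M l" "pisot_number l"
    using assms(2) unfolding irreducible_pisot_def by blast
  have L: "\<And>i. 0 < L $ i" "L v* map_matrix of_int ?M = l *s L"
    using assms(3) pf_eigenvalue_unique[OF l(1)] unfolding left_pf_eigenvector_def by blast+
  have R: "\<And>i. 0 < R $ i" "map_matrix of_int ?M *v R = l *s R"
    using assms(4) pf_eigenvalue_unique[OF l(1)] unfolding right_pf_eigenvector_def by blast+
  interpret rauzy_setting \<theta> L R l
  proof
    show "compatible \<theta>" using assms(2) by (simp add: irreducible_pisot_def)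
    show "1 < l" using l(2) by (simp add: pisot_number_def)
    show "(\<Sum>i\<in>UNIV. R $ i) = 1" using assms(5) R(1) by (simp add: less_imp_le)
    show "summable (\<lambda>n. norm (((*v) (map_matrix real_of_int ?M) ^^ n) x))" if "L \<bullet> x = 0" for x
      using assms(2) summable_norm_powers_on_hyperplane[OF _ _ l R L(2) assms(6) that]
      unfolding irreducible_pisot_def primitive_subst_def by blast
  qed (use assms L R in auto)
  show ?thesis using normalised_rauzy_measure_continuous[OF assms(7)] by blast
qed

end
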